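(* Let $Q_\infty^\infty$ be the uniform infinite half-planar quadrangulation (UIHPQ) constructed from a uniform infinite treed bridge, with the associated vertex labels $\ell$. Almost surely, all geodesic rays in $Q_\infty^\infty$ are proper, i.e. every geodesic ray $\gamma=(\gamma(i):i\in\mathbb Z_+)$ (started from an arbitrary vertex) satisfies $\ell(\gamma(i+1))=\ell(\gamma(i))-1$ for every $i\in\mathbb Z_+$.
   Context: Notation: $\mathbb Z_+=\{0,1,2,\dots\}$. **Uniform infinite treed bridge.** A well-labeled tree $(\tau,\ell)$ is a finite rooted plane tree $\tau$ with integer vertex labels $\ell$ such that labels of adjacent vertices differ by at most 1. For $k\in\mathbb Z$, $\rho_k$ is the probability measure on well-labeled trees with root label $k$ given by $\rho_k((\tau,\ell))=\tfrac12 12^{-|\tau|}$, $|\tau|$ the number of edges. Let $b=(b(i):i\in\mathbb Z)$ be a two-sided simple symmetric random walk with $b(0)=0$ (the sides $i\ge0$ and $i\le0$ are independent simple symmetric random walks from $0$). An index $i$ is a down-step if $b(i+1)=b(i)-1$; $DS(b)$ is the set of down-steps. Conditionally on $b$, let $T(i)$, $i\in DS(b)$, be independent well-labeled trees with $T(i)$ of law $\rho_{b(i)}$. **The UIHPQ.** Embed $\mathbb Z$ as a horizontal line with $i$ labeled $b(i)$, and for $i\in DS(b)$ graft $T(i)$ in the upper half-plane, identifying its root with the vertex $i$. Vertices of the trees $T(i)$ (including the roots $i\in DS(b)$) are called real; $\ell(v)$ denotes the label of a real vertex $v$ in its tree. A real corner is a corner (angular sector between consecutive edges) in the upper half-plane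 incident to a real vertex. List the real corners in left-to-right (clockwise contour) order as $(c_n)_{n\in\mathbb Z}$, where $c_0$ is the leftmost real corner with label $0$ belonging to a tree $T(i)$ with $i\in DS(b)\cap\mathbb Z_+$; the label of a corner is the label of its vertex. The successor $\mathrm{succ}(c_n)$ is the first corner among $c_{n+1},c_{n+2},\dots$ with label $\ell(c_n)-1$ (it exists almost surely). The UIHPQ $Q_\infty^\infty$ is the infinite planar map whose vertices are the real vertices and whose edges are the arcs (drawn without crossings in the upper half-plane) joining $c_n$ to $\mathrm{succ}(c_n)$, for all $n\in\mathbb Z$ (multiple edges are possible). **Geodesic rays.** With $d_{\mathrm{gr}}$ the graph distance on $Q_\infty^\infty$, a geodesic ray is an infinite path visiting vertices $\gamma(0),\gamma(1),\dots$ with $d_{\mathrm{gr}}(\gamma(i),\gamma(j))=|i-j|$ for all $i,j\in\mathbb Z_+$. *)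

theory Defs
  imports "HOL-Probability.Probability" "HOL-Library.Extended_Nat"
begin

section \<open>Labeled plane trees\<close>

text \<open>A finite rooted plane tree with integer vertex labels; the children of a vertex are listed
  from left to right. A vertex is addressed by the list of child indices leading to it from the
  root.\<close>

datatype ltree = Node (root_label: int) (children: "ltree list")

fun n_edges :: "ltree \<Rightarrow> nat" where
  "n_edges (Node l ts) = (\<Sum>t\<leftarrow>ts. Suc (n_edges t))"

fun well_labeled :: "ltree \<Rightarrow> bool" where
  "well_labeled (Node l ts) \<longleftrightarrow> (\<forall>t\<in>set ts. \<bar>root_label t - l\<bar> \<le> 1 \<and> well_labeled t)"

fun is_vertex :: "ltree \<Rightarrow> nat list \<Rightarrow> bool" where
  "is_vertex t [] \<longleftrightarrow> True"
| "is_vertex t (j # p) \<longleftrightarrow> j < length (children t) \<and> is_vertex (children t ! j) p"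

fun label_at :: "ltree \<Rightarrow> nat list \<Rightarrow> int" where
  "label_at t [] = root_label t"
| "label_at t (j # p) = label_at (children t ! j) p"

text \<open>The clockwise contour of a tree drawn above a horizontal line through its root: each visit of
  a vertex is one of its corners in the upper half-plane. A vertex with \<open>k\<close> children, the root
  included, has \<open>k + 1\<close> of them, so a tree with \<open>n\<close> edges has \<open>2 * n + 1\<close> corners.
  In the forest version, \<open>j\<close> is the child index of the first tree of the list.\<close>

fun contour :: "ltree \<Rightarrow> nat list list"
  and contour_forest :: "nat \<Rightarrow> ltree list \<Rightarrow> nat list list" where
  "contour (Node l ts) = [] # contour_forest 0 ts"
| "contour_forest j [] = []"
| "contour_forest j (t # ts) = map ((#) j) (contour t) @ [] # contour_forest (Suc j) ts"

definition rho :: "int \<Rightarrow> ltree measure" where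
  "rho k = density (count_space UNIV)
     (\<lambda>t. if well_labeled t \<and> root_label t = k then ennreal (1 / 2 * (1 / 12) ^ n_edges t) else 0)"

section \<open>The uniform infinite treed bridge\<close>

definition DS :: "(int \<Rightarrow> int) \<Rightarrow> int set" where
  "DS b = {i. b (i + 1) = b i - 1}"

definition (in prob_space) simple_random_walk :: "(nat \<Rightarrow> 'a \<Rightarrow> int) \<Rightarrow> bool" where
  "simple_random_walk X \<longleftrightarrow>
     (AE \<omega> in M. X 0 \<omega> = 0) \<and>
     indep_vars (\<lambda>_. count_space UNIV) (\<lambda>n \<omega>. X (Suc n) \<omega> - X n \<omega>) UNIV \<and>
     (\<forall>n. distr M (count_space UNIV) (\<lambda>\<omega>. X (Suc n) \<omega> - X n \<omega>) = measure_pmf (pmf_of_set {-1, 1}))"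

text \<open>The trees are indexed by all integers, but the values of \<open>T\<close> outside the set of down-steps
  are unconstrained (apart from measurability) and are never used. The last assumption says that,
  conditionally on \<open>b\<close>, the trees at the down-steps are independent with laws \<open>rho (b i)\<close>: it gives
  the conditional probability that all indices in a finite set \<open>J\<close> are down-steps carrying
  prescribed trees.\<close>

locale uniform_infinite_treed_bridge = prob_space M for M :: "'w measure" +
  fixes b :: "'w \<Rightarrow> int \<Rightarrow> int" and T :: "'w \<Rightarrow> int \<Rightarrow> ltree"
  assumes measurable_b: "\<And>i. (\<lambda>\<omega>. b \<omega> i) \<in> measurable M (count_space UNIV)"
    and measurable_T: "\<And>i. (\<lambda>\<omega>. T \<omega> i) \<in> measurable M (count_space UNIV)"
    and walk_right: "simple_random_walk (\<lambda>n \<omega>. b \<omega> (int n))"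
    and walk_left: "simple_random_walk (\<lambda>n \<omega>. b \<omega> (- int n))"
    and indep_sides:
      "indep_var (Pi\<^sub>M UNIV (\<lambda>_. count_space UNIV)) (\<lambda>\<omega> n::nat. b \<omega> (int n))
                 (Pi\<^sub>M UNIV (\<lambda>_. count_space UNIV)) (\<lambda>\<omega> n::nat. b \<omega> (- int n))"
    and trees_given_bridge:
      "\<And>(J :: int set) (t :: int \<Rightarrow> ltree). finite J \<Longrightarrow>
         AE \<omega> in M.
           real_cond_exp M (vimage_algebra (space M) b (Pi\<^sub>M UNIV (\<lambda>_. count_space UNIV)))
             (indicator {\<omega> \<in> space M. \<forall>j\<in>J. j \<in> DS (b \<omega>) \<and> T \<omega> j = t j}) \<omega>
           = (if J \<subseteq> DS (b \<omega>) then \<Prod>j\<in>J. measure (rho (b \<omega> j)) {t j} else 0)"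

section \<open>The UIHPQ of a treed bridge\<close>

text \<open>A real vertex is a pair of a down-step and a vertex address in the tree grafted there; a real
  corner is a pair of a down-step and a position in the contour of that tree. The left-to-right
  order of corners is lexicographic.\<close>

type_synonym vertex = "int \<times> nat list"
type_synonym corner = "int \<times> nat"

definition real_vertices :: "(int \<Rightarrow> int) \<Rightarrow> (int \<Rightarrow> ltree) \<Rightarrow> vertex set" where
  "real_vertices b T = {(i, p). i \<in> DS b \<and> is_vertex (T i) p}"

definition vertex_label :: "(int \<Rightarrow> ltree) \<Rightarrow> vertex \<Rightarrow> int" where
  "vertex_label T v = label_at (T (fst v)) (snd v)"

definition real_corners :: "(int \<Rightarrow> int) \<Rightarrow> (int \<Rightarrow> ltree) \<Rightarrow> corner set" where
  "real_corners b T = {(i, k). i \<in> DS b \<and> k < length (contour (T i))}"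

definition corner_vertex :: "(int \<Rightarrow> ltree) \<Rightarrow> corner \<Rightarrow> vertex" where
  "corner_vertex T c = (fst c, contour (T (fst c)) ! snd c)"

definition corner_label :: "(int \<Rightarrow> ltree) \<Rightarrow> corner \<Rightarrow> int" where
  "corner_label T c = vertex_label T (corner_vertex T c)"

definition corner_less :: "corner \<Rightarrow> corner \<Rightarrow> bool" where
  "corner_less c d \<longleftrightarrow> fst c < fst d \<or> fst c = fst d \<and> snd c < snd d"

definition is_origin_corner :: "(int \<Rightarrow> int) \<Rightarrow> (int \<Rightarrow> ltree) \<Rightarrow> corner \<Rightarrow> bool" where
  "is_origin_corner b T c \<longleftrightarrow>
     (let Z = {d \<in> real_corners b T. 0 \<le> fst d \<and> corner_label T d = 0}
      in c \<in> Z \<and> (\<forall>d\<in>Z. \<not> corner_less d c))"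

text \<open>The enumeration of the real corners from left to right by the integers. The conditions
  determine it uniquely; it exists whenever \<open>DS b\<close> is unbounded in both directions and an origin
  corner exists, hence almost surely.\<close>

definition corner_seq :: "(int \<Rightarrow> int) \<Rightarrow> (int \<Rightarrow> ltree) \<Rightarrow> int \<Rightarrow> corner" where
  "corner_seq b T = (THE c. bij_betw c UNIV (real_corners b T) \<and>
     (\<forall>m n. m < n \<longrightarrow> corner_less (c m) (c n)) \<and> is_origin_corner b T (c 0))"

text \<open>The index of the successor of the \<open>n\<close>-th corner.\<close>

definition succ_index :: "(int \<Rightarrow> int) \<Rightarrow> (int \<Rightarrow> ltree) \<Rightarrow> int \<Rightarrow> int" where
  "succ_index b T n = (LEAST m. n < m \<and>
     corner_label T (corner_seq b T m) = corner_label T (corner_seq b T n) - 1)"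

text \<open>The edges form a family indexed by the integers, so that multiple edges are allowed. The
  planar embedding is not recorded: the graph distance and the labels do not depend on it.\<close>

definition uihpq_edge :: "(int \<Rightarrow> int) \<Rightarrow> (int \<Rightarrow> ltree) \<Rightarrow> int \<Rightarrow> vertex set" where
  "uihpq_edge b T n =
     {corner_vertex T (corner_seq b T n), corner_vertex T (corner_seq b T (succ_index b T n))}"

definition uihpq_adj :: "(int \<Rightarrow> int) \<Rightarrow> (int \<Rightarrow> ltree) \<Rightarrow> (vertex \<times> vertex) set" where
  "uihpq_adj b T = {(u, v). \<exists>n. uihpq_edge b T n = {u, v}}"

section \<open>Geodesic rays\<close>

definition graph_dist :: "('v \<times> 'v) set \<Rightarrow> 'v \<Rightarrow> 'v \<Rightarrow> enat" where
  "graph_dist E u v = Inf {enat n | n. (u, v) \<in> E ^^ n}"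

definition geodesic_ray :: "'v set \<Rightarrow> ('v \<times> 'v) set \<Rightarrow> (nat \<Rightarrow> 'v) \<Rightarrow> bool" where
  "geodesic_ray V E \<gamma> \<longleftrightarrow>
     (\<forall>i. \<gamma> i \<in> V) \<and> (\<forall>i. (\<gamma> i, \<gamma> (Suc i)) \<in> E) \<and>
     (\<forall>i j. graph_dist E (\<gamma> i) (\<gamma> j) = enat (nat \<bar>int i - int j\<bar>))"

definition proper_ray :: "('v \<Rightarrow> int) \<Rightarrow> (nat \<Rightarrow> 'v) \<Rightarrow> bool" where
  "proper_ray l \<gamma> \<longleftrightarrow> (\<forall>i. l (\<gamma> (Suc i)) = l (\<gamma> i) - 1)"

end

theory Submission
  imports Defs "HOL-Library.Countable"
begin

text \<open>Every edge of the map joins the \<open>n\<close>-th corner to a later one with label smaller by one, and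
  between the two no label is smaller than that of the \<open>n\<close>-th corner. Call a vertex a hit if one of its
  corners is the first corner of the trees to the right of the origin with its label. From any vertex
  \<open>u\<close>, iterating successors reaches every hit of low enough label \<open>k\<close> in \<open>\<ell>(u) - k\<close> steps, so a
  geodesic ray from \<open>u\<close> can only descend before it visits such a hit; a ray visiting infinitely many
  hits is therefore proper. An edge between the two sides of the origin always ends in a hit. A ray
  that finally stays on the right has to pass through the roots of the trees at right bottlenecks,
  the down-steps \<open>j \<ge> 0\<close> such that all trees between \<open>0\<close> and \<open>j\<close> have labels larger than \<open>b(j)\<close>; these
  are hits. A ray cannot finally stay on the left, because no edge crosses a left bottleneck.

  Bottlenecks occur infinitely often because they are renewal events with infinite expected
  number. A tree with root label \<open>h\<close> has positive labels with probability
  \<open>h (h + 3) / ((h + 1) (h + 2))\<close>, and the resulting Green function of the walk killed by negative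
  labels behaves like \<open>1 / (h + 1)\<close>, whose sum over \<open>h\<close> diverges.\<close>

section \<open>Generating functions of labeled trees\<close>

text \<open>Two obstacles shape the proof. First, the trees depend on the bridge, since the law of a
  tree is centred at \<open>b i\<close>. Recentring every tree at its root label turns each half of
  the bridge into a sequence of i.i.d. marks (a step, possibly with a tree). Second, the divergence
  of the expected number of bottlenecks is a borderline matter: a tree stays positive with
  probability 1 - 2 / ((h + 1) (h + 2)), so the Green function solves a discrete version of h^2 G''
  = 2 G, whose solutions behave like h^2 and 1 / h, and the decaying one just fails to be summable.
  The coefficient 2 decides this, which is why the generating function of trees with positive labels
  is computed exactly. Moreover, the two sides are not mirror images of each other: trees hang at
  the left ends of down-steps, so that, read from 0 to the left, a tree comes with an upward step. A
  reversal identity reduces both sides to the same weighted walk.\<close>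

instance ltree :: countable
  by countable_datatype

fun labels_in :: "int set \<Rightarrow> ltree \<Rightarrow> bool" where
  "labels_in S (Node l ts) \<longleftrightarrow> l \<in> S \<and> (\<forall>t\<in>set ts. labels_in S t)"

fun shift_labels :: "int \<Rightarrow> ltree \<Rightarrow> ltree" where
  "shift_labels c (Node l ts) = Node (l + c) (map (shift_labels c) ts)"

lemma root_label_shift [simp]: "root_label (shift_labels c t) = root_label t + c"
  by (cases t) auto

lemma shift_labels_shift_labels: "shift_labels c (shift_labels d t) = shift_labels (d + c) t"
  by (induction t) (auto simp: algebra_simps)

lemma shift_labels_0 [simp]: "shift_labels 0 t = t"
  by (induction t) (auto simp: map_idI)

lemma bij_shift_labels: "bij (shift_labels c)"
  by (rule o_bij[where g = "shift_labels (- c)"]) (auto simp: shift_labels_shift_labels fun_eq_iff)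

lemma n_edges_shift [simp]: "n_edges (shift_labels c t) = n_edges t"
  by (induction t) (auto intro!: arg_cong[where f = sum_list])

lemma well_labeled_shift [simp]: "well_labeled (shift_labels c t) = well_labeled t"
  by (induction t) auto

lemma labels_in_shift: "labels_in S (shift_labels c t) = labels_in ((\<lambda>x. x + c) -` S) t"
  by (induction t) auto

lemma labels_in_UNIV [simp]: "labels_in UNIV t"
  by (induction t) auto

lemma labels_in_mono: "labels_in S t \<Longrightarrow> S \<subseteq> S' \<Longrightarrow> labels_in S' t"
  by (induction t) auto

text \<open>Cutting the edge from the root to its leftmost child splits every tree with an edge into
  a unique pair \<open>(s, t)\<close>; this is the decomposition behind the quadratic
  recursion.\<close>

definition attach :: "ltree \<Rightarrow> ltree \<Rightarrow> ltree" where
  "attach s t = Node (root_label t) (s # children t)"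

text \<open>The factor 1/2 of \<open>rho\<close> is left out, so that weights multiply under
  \<open>attach\<close>, up to the factor 1/12 of the new edge.\<close>

definition tree_weight :: "int set \<Rightarrow> int \<Rightarrow> ltree \<Rightarrow> ennreal" where
  "tree_weight S k t =
     (if well_labeled t \<and> root_label t = k \<and> labels_in S t then ennreal ((1 / 12) ^ n_edges t) else 0)"

definition tree_sum :: "int set \<Rightarrow> int \<Rightarrow> ennreal" where
  "tree_sum S k = (\<integral>\<^sup>+t. tree_weight S k t \<partial>count_space UNIV)"

text \<open>The three summands are the labels allowed for the new child; for a given
  \<open>s\<close> at most one of them is non-zero.\<close>

lemma tree_weight_attach:
  "tree_weight S k (attach s t) =
     ennreal (1 / 12) * (tree_weight S (k - 1) s + tree_weight S k s + tree_weight S (k + 1) s) * tree_weight S k t"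
proof -
  obtain l ts where t: "t = Node l ts" by (cases t)
  have near: "\<bar>root_label s - k\<bar> \<le> 1 \<longleftrightarrow> root_label s \<in> {k - 1, k, k + 1}" by auto
  have sum: "tree_weight S (k - 1) s + tree_weight S k s + tree_weight S (k + 1) s =
    (if well_labeled s \<and> \<bar>root_label s - k\<bar> \<le> 1 \<and> labels_in S s then ennreal ((1 / 12) ^ n_edges s) else 0)"
    unfolding near by (auto simp: tree_weight_def)
  show ?thesis
    unfolding sum
    by (auto simp: t attach_def tree_weight_def power_add ennreal_mult''[symmetric] mult_ac)
qed

text \<open>The weight \<open>F\<close> is arbitrary because the decomposition is applied to the
  full weights and to weights truncated by the number of edges.\<close>

lemma nn_integral_trees_attach:
  fixes F :: "ltree \<Rightarrow> ennreal"
  assumes "\<And>t. root_label t \<noteq> k \<Longrightarrow> F t = 0"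
  shows "(\<integral>\<^sup>+t. F t \<partial>count_space UNIV) =
    F (Node k []) + (\<integral>\<^sup>+s. (\<integral>\<^sup>+t. F (attach s t) \<partial>count_space UNIV) \<partial>count_space UNIV)"
proof -
  let ?R = "range (\<lambda>(s, t). attach s t)"
  have inj: "inj (\<lambda>(s, t). attach s t)"
    by (auto simp: inj_def attach_def intro: ltree.expand)
  have R: "t \<in> ?R \<longleftrightarrow> children t \<noteq> []" for t
  proof (cases t)
    case (Node l ts)
    show ?thesis
    proof (cases ts)
      case (Cons u us)
      then have "t = attach u (Node l us)" by (simp add: Node attach_def)
      then have "t \<in> ?R" by (auto intro!: image_eqI[where x = "(u, Node l us)"])
      then show ?thesis using Node Cons by simp
    qed (auto simp: Node attach_def)
  qed
  have split: "F t = F (Node k []) * indicator {Node k []} t + F t * indicator ?R t" for t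
  proof (cases "t \<in> ?R")
    case True
    then show ?thesis using R[of t] by (auto simp: indicator_def)
  next
    case False
    then show ?thesis using R[of t] assms[of t] by (cases t) (auto simp: indicator_def)
  qed
  have "(\<integral>\<^sup>+t. F t \<partial>count_space UNIV) =
     (\<integral>\<^sup>+t. F (Node k []) * indicator {Node k []} t \<partial>count_space UNIV)
     + (\<integral>\<^sup>+t. F t * indicator ?R t \<partial>count_space UNIV)"
    by (subst nn_integral_add[symmetric]) (auto intro!: nn_integral_cong split)
  also have "(\<integral>\<^sup>+t. F t * indicator ?R t \<partial>count_space UNIV) = (\<integral>\<^sup>+t. F t \<partial>count_space ?R)"
    by (simp add: nn_integral_count_space_indicator)
  also have "\<dots> = (\<integral>\<^sup>+x. F (case x of (s, t) \<Rightarrow> attach s t) \<partial>count_space UNIV)"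
    by (rule nn_integral_bij_count_space[symmetric]) (use inj in \<open>simp add: bij_betw_def\<close>)
  also have "\<dots> = (\<integral>\<^sup>+s. (\<integral>\<^sup>+t. F (attach s t) \<partial>count_space UNIV) \<partial>count_space UNIV)"
    by (subst nn_integral_fst_count_space[symmetric]) simp
  finally show ?thesis by simp
qed

lemma tree_sum_rec:
  "k \<in> S \<Longrightarrow> tree_sum S k = 1 + ennreal (1 / 12) * (tree_sum S (k - 1) + tree_sum S k + tree_sum S (k + 1)) * tree_sum S k"
proof -
  assume "k \<in> S"
  have "tree_sum S k = tree_weight S k (Node k []) +
     (\<integral>\<^sup>+s. (\<integral>\<^sup>+t. tree_weight S k (attach s t) \<partial>count_space UNIV) \<partial>count_space UNIV)"
    unfolding tree_sum_def by (rule nn_integral_trees_attach) (simp add: tree_weight_def)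
  also have "tree_weight S k (Node k []) = 1"
    using \<open>k \<in> S\<close> by (simp add: tree_weight_def)
  finally show ?thesis
    by (simp add: tree_sum_def tree_weight_attach nn_integral_cmult nn_integral_multc nn_integral_add)
qed

lemma tree_sum_outside: "k \<notin> S \<Longrightarrow> tree_sum S k = 0"
proof -
  assume "k \<notin> S"
  then have "tree_weight S k t = 0" for t
    by (cases t) (auto simp: tree_weight_def)
  then show ?thesis by (simp add: tree_sum_def)
qed

text \<open>In \<open>ennreal\<close> the recursion is also solved by infinity, so finiteness is
  proved by induction on the number of edges. The bound 2 reproduces itself because
  \<open>1 + (2 + 2 + 2) * 2 / 12 = 2\<close>.\<close>

lemma tree_sum_le_2: "tree_sum S k \<le> 2"
proof -
  let ?W = "\<lambda>n k t. tree_weight S k t * indicator {t. n_edges t \<le> n} t"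
  have le: "(\<integral>\<^sup>+t. ?W n k t \<partial>count_space UNIV) \<le> 2" for n k
  proof (induction n arbitrary: k)
    case 0
    have "?W 0 k t \<le> indicator {Node k []} t" for t
      by (cases t; cases "children t") (auto simp: tree_weight_def indicator_def)
    then have "(\<integral>\<^sup>+t. ?W 0 k t \<partial>count_space UNIV) \<le> (\<integral>\<^sup>+t. indicator {Node k []} t \<partial>count_space UNIV)"
      by (intro nn_integral_mono) simp
    then show ?case by (simp add: order_trans)
  next
    case (Suc n)
    have "(\<integral>\<^sup>+t. ?W (Suc n) k t \<partial>count_space UNIV) = ?W (Suc n) k (Node k []) +
        (\<integral>\<^sup>+s. (\<integral>\<^sup>+t. ?W (Suc n) k (attach s t) \<partial>count_space UNIV) \<partial>count_space UNIV)"
      by (rule nn_integral_trees_attach) (simp add: tree_weight_def)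
    also have "?W (Suc n) k (Node k []) \<le> 1"
      by (auto simp: tree_weight_def indicator_def)
    also have "(\<integral>\<^sup>+s. (\<integral>\<^sup>+t. ?W (Suc n) k (attach s t) \<partial>count_space UNIV) \<partial>count_space UNIV) \<le>
       (\<integral>\<^sup>+s. (\<integral>\<^sup>+t. ennreal (1 / 12) * (?W n (k - 1) s + ?W n k s + ?W n (k + 1) s) * ?W n k t
           \<partial>count_space UNIV) \<partial>count_space UNIV)"
    proof (intro nn_integral_mono)
      fix s t
      have "n_edges (attach s t) = Suc (n_edges s + n_edges t)"
        by (cases t) (simp add: attach_def)
      then show "?W (Suc n) k (attach s t) \<le>
          ennreal (1 / 12) * (?W n (k - 1) s + ?W n k s + ?W n (k + 1) s) * ?W n k t"
        by (auto simp: tree_weight_attach indicator_def)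
    qed
    also have "\<dots> = ennreal (1 / 12) * ((\<integral>\<^sup>+s. ?W n (k - 1) s \<partial>count_space UNIV) +
        (\<integral>\<^sup>+s. ?W n k s \<partial>count_space UNIV) + (\<integral>\<^sup>+s. ?W n (k + 1) s \<partial>count_space UNIV)) *
        (\<integral>\<^sup>+t. ?W n k t \<partial>count_space UNIV)"
      by (simp add: nn_integral_cmult nn_integral_multc nn_integral_add)
    also have "\<dots> \<le> ennreal (1 / 12) * (2 + 2 + 2) * 2"
      by (intro mult_mono add_mono Suc) auto
    also have "\<dots> = ennreal (1 / 12) * ennreal 12" by (simp add: mult.assoc)
    also have "\<dots> = 1" by (subst ennreal_mult''[symmetric]) auto
    finally show ?case
      by (simp add: add_mono)
  qed
  have "tree_sum S k = (\<integral>\<^sup>+t. (SUP n. ?W n k t) \<partial>count_space UNIV)"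
    unfolding tree_sum_def
  proof (intro nn_integral_cong antisym)
    fix t
    show "tree_weight S k t \<le> (SUP n. ?W n k t)"
      by (rule SUP_upper2[of "n_edges t"]) auto
    show "(SUP n. ?W n k t) \<le> tree_weight S k t"
      by (rule SUP_least) (auto simp: indicator_def)
  qed
  also have "\<dots> = (SUP n. \<integral>\<^sup>+t. ?W n k t \<partial>count_space UNIV)"
    by (rule nn_integral_monotone_convergence_SUP)
       (auto simp: incseq_def le_fun_def indicator_def)
  also have "\<dots> \<le> 2" by (intro SUP_least le)
  finally show ?thesis .
qed

lemma tree_sum_shift: "tree_sum S (k + c) = tree_sum ((\<lambda>x. x + c) -` S) k"
  unfolding tree_sum_def
  by (subst nn_integral_bij_count_space[OF bij_shift_labels[of c], symmetric])
     (simp add: tree_weight_def[abs_def] labels_in_shift cong: if_cong)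

section \<open>Explicit solution of the tree recursion\<close>

definition tree_val :: "int set \<Rightarrow> int \<Rightarrow> real" where
  "tree_val S k = enn2real (tree_sum S k)"

lemma tree_sum_eq_val: "tree_sum S k = ennreal (tree_val S k)"
  unfolding tree_val_def using tree_sum_le_2[of S k]
  by (intro ennreal_enn2real[symmetric]) (auto simp: order_le_less_trans)

lemma tree_val_nonneg: "0 \<le> tree_val S k"
  by (simp add: tree_val_def)

lemma tree_val_le_2: "tree_val S k \<le> 2"
  using tree_sum_le_2[of S k] ennreal_le_iff[of 2 "tree_val S k"] by (simp add: tree_sum_eq_val)

lemma tree_val_rec:
  assumes "k \<in> S"
  shows "tree_val S k = 1 + (tree_val S (k - 1) + tree_val S k + tree_val S (k + 1)) * tree_val S k / 12"
proof -
  have "ennreal (tree_val S k) = ennreal (1 + (1 / 12) * (tree_val S (k - 1) + tree_val S k + tree_val S (k + 1)) * tree_val S k)"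
    using tree_sum_rec[OF assms] tree_val_nonneg
    by (simp add: tree_sum_eq_val ennreal_plus[symmetric] ennreal_mult''[symmetric] ennreal_1[symmetric] del: ennreal_plus ennreal_1)
  then show ?thesis using tree_val_nonneg by (subst (asm) ennreal_inj) auto
qed

text \<open>Translation invariance turns the recursion into \<open>x = 1 + x * x / 4\<close>, which
  has the double root 2: the weight 1/12 is critical, and \<open>rho\<close> has total mass
  1.\<close>

lemma tree_val_UNIV: "tree_val UNIV k = 2"
proof -
  have const: "tree_val UNIV j = tree_val UNIV k" for j
    using tree_sum_shift[of UNIV k "j - k"] by (simp add: tree_val_def)
  have "tree_val UNIV k = 1 + (3 * tree_val UNIV k) * tree_val UNIV k / 12"
    using tree_val_rec[of k UNIV] const[of "k - 1"] const[of "k + 1"] by simp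
  then have "(tree_val UNIV k - 2)\<^sup>2 = 0" by (simp add: power2_eq_square algebra_simps)
  then show ?thesis by simp
qed

text \<open>Twice this function is the classical closed-form solution of the critical tree recursion
  on the positive integers that vanishes at 0.\<close>

definition pos_frac :: "nat \<Rightarrow> real" where
  "pos_frac h = real h * (real h + 3) / ((real h + 1) * (real h + 2))"

lemma pos_frac_le_1: "pos_frac h \<le> 1"
  by (simp add: pos_frac_def divide_simps) (simp add: algebra_simps)

lemma pos_frac_nonneg: "0 \<le> pos_frac h"
  by (simp add: pos_frac_def)

lemma pos_frac_pos: "0 < h \<Longrightarrow> 0 < pos_frac h"
  by (simp add: pos_frac_def)

lemma pos_frac_rec:
  "2 * pos_frac (Suc h) = 1 + (2 * pos_frac h + 2 * pos_frac (Suc h) + 2 * pos_frac (Suc (Suc h))) * (2 * pos_frac (Suc h)) / 12"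
proof -
  define x where "x = real h"
  have "x \<ge> 0" by (simp add: x_def)
  have a: "x + 1 \<noteq> 0" "x + 2 \<noteq> 0" "x + 3 \<noteq> 0" "x + 4 \<noteq> 0" using \<open>x \<ge> 0\<close> by auto
  have 0: "pos_frac h = x * (x + 3) / ((x + 1) * (x + 2))"
    and 1: "pos_frac (Suc h) = (x + 1) * (x + 4) / ((x + 2) * (x + 3))"
    and 2: "pos_frac (Suc (Suc h)) = (x + 2) * (x + 5) / ((x + 3) * (x + 4))"
    by (simp_all add: pos_frac_def x_def algebra_simps)
  show ?thesis unfolding 0 1 2 using a
    by (simp add: divide_simps) algebra
qed

text \<open>A discrete maximum principle. If \<open>d 1\<close> were positive, the increments could
  never fall below \<open>d 1\<close>, because the coefficient is at least 2, and \<open>d\<close>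
  would grow linearly; \<open>- d\<close> is treated alike. The coefficient may vary with
  \<open>n\<close>, as it does for the difference of two solutions of a non-linear
  recursion.\<close>

lemma convex_bounded_imp_zero:
  fixes d :: "nat \<Rightarrow> real"
  assumes conv: "\<And>n. \<exists>c\<ge>2. d (Suc (Suc n)) = c * d (Suc n) - d n"
    and "d 0 = 0" and bdd: "\<And>n. \<bar>d n\<bar> \<le> B"
  shows "d n = 0"
proof -
  have main: "e 1 \<le> 0" if conv: "\<And>n. \<exists>c\<ge>2. e (Suc (Suc n)) = c * e (Suc n) - e n"
    and "e 0 = 0" and bdd: "\<And>n. \<bar>e n\<bar> \<le> B" for e :: "nat \<Rightarrow> real"
  proof (rule ccontr)
    assume "\<not> e 1 \<le> 0"
    then have pos: "e 1 > 0" by simp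
    have "e (Suc n) \<ge> e n + e 1 \<and> e n \<ge> 0" for n
    proof (induction n)
      case 0
      then show ?case using \<open>e 0 = 0\<close> by simp
    next
      case (Suc n)
      obtain c where "c \<ge> 2" "e (Suc (Suc n)) = c * e (Suc n) - e n" using conv by blast
      moreover have "c * e (Suc n) \<ge> 2 * e (Suc n)"
        using \<open>c \<ge> 2\<close> Suc pos by (intro mult_right_mono) auto
      ultimately show ?case using Suc pos by linarith
    qed
    then have "e n \<ge> real n * e 1" for n
      by (induction n) (auto simp: algebra_simps, smt)
    moreover obtain n where "real n * e 1 > B"
      using reals_Archimedean3[OF pos] by blast
    ultimately show False using bdd[of n] by (smt (verit))
  qed
  have "d 1 \<le> 0" by (rule main[OF assms])
  moreover have "- d 1 \<le> 0"
    by (rule main) (use assms in \<open>auto simp: algebra_simps, metis\<close>)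
  ultimately have "d 1 = 0" by simp
  have "d n = 0 \<and> d (Suc n) = 0"
  proof (induction n)
    case 0
    then show ?case using \<open>d 0 = 0\<close> \<open>d 1 = 0\<close> by simp
  next
    case (Suc n)
    then show ?case using conv[of n] by auto
  qed
  then show ?thesis ..
qed

text \<open>The recursion is of second order but comes with a single boundary value, at 0; the
  boundedness of both solutions replaces the missing one.\<close>

lemma tree_val_positive: "tree_val {0<..} (int h) = 2 * pos_frac h"
proof -
  let ?R = "\<lambda>h. tree_val {0<..} (int h)"
  define d where "d h = ?R h - 2 * pos_frac h" for h
  have rec: "?R (Suc h) = 1 + (?R h + ?R (Suc h) + ?R (Suc (Suc h))) * ?R (Suc h) / 12" for h
    using tree_val_rec[of "int (Suc h)" "{0<..}"] by (simp add: algebra_simps)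
  have "d h = 0"
  proof (rule convex_bounded_imp_zero[where d = d and B = 2])
    show "d 0 = 0" by (simp add: d_def pos_frac_def tree_val_def tree_sum_outside)
    show "\<bar>d n\<bar> \<le> 2" for n
      using tree_val_nonneg[of "{0<..}" "int n"] tree_val_le_2[of "{0<..}" "int n"]
        pos_frac_le_1[of n] pos_frac_nonneg[of n] by (auto simp: d_def)
    fix n
    let ?x = "?R (Suc n)" and ?y = "2 * pos_frac (Suc n)"
    have x: "?x \<ge> 1"
      using rec[of n] tree_val_nonneg[of "{0<..}"] by (smt (verit) mult_nonneg_nonneg divide_nonneg_pos)
    have y: "?y > 0" using pos_frac_pos[of "Suc n"] by simp
    have xy: "?x * ?y \<le> 2 * 2"
      using x y tree_val_le_2[of "{0<..}"] pos_frac_le_1[of "Suc n"] by (intro mult_mono) auto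
    \<comment> \<open>Solved for the next value, the recursion reads 12 - 12 / x - x minus the
      previous value. The difference quotient of 12 - 12 / x - x is \<open>12 / (x * y) - 1\<close>,
      which is at least 2 because both values are at most 2.\<close>
    have "12 / (?x * ?y) \<ge> 3"
      using xy x y by (simp add: divide_simps)
    moreover have "?R (Suc (Suc n)) = 12 - 12 / ?x - ?x - ?R n"
      using rec[of n] x by (simp add: field_simps)
    moreover have "2 * pos_frac (Suc (Suc n)) = 12 - 12 / ?y - ?y - 2 * pos_frac n"
      using pos_frac_rec[of n] y by (simp add: field_simps)
    moreover have "(12 / (?x * ?y)) * (?x - ?y) = 12 / ?y - 12 / ?x"
      using x y by (simp add: field_simps)
    ultimately show "\<exists>c\<ge>2. d (Suc (Suc n)) = c * d (Suc n) - d n"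
      by (intro exI[of _ "12 / (?x * ?y) - 1"]) (auto simp: d_def algebra_simps)
  qed
  then show ?thesis by (simp add: d_def)
qed

section \<open>Weighted walks and renewal events\<close>

text \<open>Decomposition by the first step: \<open>h\<close> is the height above the final level,
  and a down-step from \<open>h\<close> carries the probability that its tree stays above that
  level. Since \<open>pos_frac 0 = 0\<close>, the truncated \<open>h - 1\<close> at
  \<open>h = 0\<close> has no effect.\<close>

fun walk_weight :: "nat \<Rightarrow> nat \<Rightarrow> real" where
  "walk_weight 0 h = of_bool (h = 0)"
| "walk_weight (Suc n) h =
     (walk_weight n (Suc h) + pos_frac h * walk_weight n (h - 1)) / 2"

lemma walk_weight_nonneg: "0 \<le> walk_weight n h"
  by (induction n arbitrary: h) (auto intro!: add_nonneg_nonneg mult_nonneg_nonneg pos_frac_nonneg)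

text \<open>If the sums were bounded, the Green function \<open>G\<close> would be finite and
  summable, and its recursion a genuine difference equation. The empty walk gives
  \<open>G 0 \<ge> 1\<close>, and the comparison with \<open>1 / (h + 1)\<close> carries this on to
  a harmonic lower bound.\<close>

lemma walk_weight_unbounded: "\<exists>H N. B < (\<Sum>h<H. \<Sum>n<N. walk_weight n h)"
proof (rule ccontr)
  assume "\<nexists>H N. B < (\<Sum>h<H. \<Sum>n<N. walk_weight n h)"
  then have bound: "(\<Sum>h<H. \<Sum>n<N. walk_weight n h) \<le> B" for H N
    by (meson not_less)
  have summ: "summable (\<lambda>n. walk_weight n h)" for h
  proof (rule summableI_nonneg_bounded[where x = B])
    fix N
    have "(\<Sum>n<N. walk_weight n h) \<le> (\<Sum>h<Suc h. \<Sum>n<N. walk_weight n h)"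
      by (rule member_le_sum) (auto intro!: sum_nonneg walk_weight_nonneg)
    then show "(\<Sum>n<N. walk_weight n h) \<le> B" using bound[where H = "Suc h" and N = N] by linarith
  qed (rule walk_weight_nonneg)
  define G where "G h = (\<Sum>n. walk_weight n h)" for h
  have G_nonneg: "0 \<le> G h" for h
    unfolding G_def by (intro suminf_nonneg summ walk_weight_nonneg)
  have G_rec: "G h = of_bool (h = 0) + (G (Suc h) + pos_frac h * G (h - 1)) / 2" for h
  proof -
    have "G h = (\<Sum>n. walk_weight (Suc n) h) + walk_weight 0 h"
      unfolding G_def by (subst suminf_split_head[OF summ]) simp
    also have "(\<Sum>n. walk_weight (Suc n) h) = (G (Suc h) + pos_frac h * G (h - 1)) / 2"
      unfolding G_def walk_weight.simps
      by (intro sums_unique[symmetric] sums_divide sums_add sums_mult summable_sums summ)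
    finally show ?thesis by simp
  qed
  have sum_G: "(\<Sum>h<H. G h) \<le> B" for H
  proof (rule LIMSEQ_le_const2)
    show "(\<lambda>N. \<Sum>h<H. \<Sum>n<N. walk_weight n h) \<longlonglongrightarrow> (\<Sum>h<H. G h)"
      unfolding G_def by (intro tendsto_sum summable_LIMSEQ summ)
  qed (use bound in blast)
  \<comment> \<open>\<open>1 / (h + 1)\<close> solves the recursion for \<open>G\<close> at \<open>h > 0\<close>; the differences of the quotient of
    \<open>G\<close> by this solution keep their sign and do not decrease in absolute value.\<close>
  define D where "D h = (real h + 2) * G (Suc h) - (real h + 1) * G h" for h
  have D_Suc: "D (Suc h) = (real h + 4) / (real h + 2) * D h" for h
  proof -
    have "G (Suc (Suc h)) = 2 * G (Suc h) - (real h + 1) * (real h + 4) / ((real h + 2) * (real h + 3)) * G h"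
      using G_rec[of "Suc h"] by (simp add: pos_frac_def algebra_simps)
    then show ?thesis
      by (simp add: D_def divide_simps) algebra
  qed
  \<comment> \<open>A negative difference would persist and push \<open>(h + 1) * G h\<close> below
    0.\<close>
  have D_nonneg: "D 0 \<ge> 0"
  proof (rule ccontr)
    assume "\<not> D 0 \<ge> 0"
    then have neg: "D 0 < 0" by simp
    have D_le: "D h \<le> D 0" for h
    proof (induction h)
      case (Suc h)
      have "D (Suc h) \<le> 1 * D h"
        unfolding D_Suc using Suc neg by (intro mult_right_mono_neg) auto
      then show ?case using Suc by simp
    qed simp
    have "(real h + 1) * G h \<le> G 0 + real h * D 0" for h
    proof (induction h)
      case (Suc h)
      then show ?case using D_le[of h] by (simp add: D_def algebra_simps)
    qed simp
    moreover obtain h :: nat where "real h * (- D 0) > G 0"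
      using reals_Archimedean3[of "- D 0"] neg by auto
    moreover have "0 \<le> (real h + 1) * G h" using G_nonneg[of h] by simp
    ultimately show False by (smt (verit) mult_minus_right)
  qed
  have D_ge: "D h \<ge> 0" for h
    by (induction h) (auto simp: D_Suc D_nonneg)
  have ge: "(real h + 1) * G h \<ge> 1" for h
  proof (induction h)
    case 0
    show ?case using G_rec[of 0] G_nonneg[of 1] by (simp add: pos_frac_def)
  next
    case (Suc h)
    then show ?case using D_ge[of h] by (simp add: D_def algebra_simps)
  qed
  have "summable (\<lambda>h. inverse (real (Suc h)))"
  proof (rule summableI_nonneg_bounded[where x = B])
    fix H
    have "(\<Sum>h<H. inverse (real (Suc h))) \<le> (\<Sum>h<H. G h)"
    proof (intro sum_mono)
      fix h show "inverse (real (Suc h)) \<le> G h"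
        using ge[of h] by (simp add: divide_simps mult.commute add.commute)
    qed
    then show "(\<Sum>h<H. inverse (real (Suc h))) \<le> B" using sum_G[of H] by linarith
  qed simp
  then show False
    using not_summable_harmonic[where 'a = real] summable_Suc_iff[of "\<lambda>h. inverse (real h)"] by blast
qed

section \<open>Recurrent events of an i.i.d. sequence\<close>

lemma replicate_pmf_take_drop:
  "measure (replicate_pmf (m + n) p) {zs. P (take m zs) \<and> Q (drop m zs)} =
   measure (replicate_pmf m p) {xs. P xs} * measure (replicate_pmf n p) {ys. Q ys}"
proof -
  have "emeasure (replicate_pmf (m + n) p) {zs. P (take m zs) \<and> Q (drop m zs)} =
    (\<integral>\<^sup>+xs. \<integral>\<^sup>+ys. indicator {xs. P xs} xs * indicator {ys. Q ys} ys \<partial>replicate_pmf n p \<partial>replicate_pmf m p)"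
    unfolding replicate_pmf_distrib emeasure_bind_pmf
    by (intro nn_integral_cong_AE AE_pmfI) (auto simp: set_replicate_pmf indicator_def)
  also have "\<dots> = emeasure (replicate_pmf m p) {xs. P xs} * emeasure (replicate_pmf n p) {ys. Q ys}"
    by (simp add: nn_integral_cmult nn_integral_multc)
  finally show ?thesis
    by (simp add: measure_pmf.emeasure_eq_measure ennreal_mult''[symmetric] measure_nonneg)
qed

text \<open>A recurrent event in the sense of Feller: once it has occurred, its later occurrences
  are those of the remaining sequence alone.\<close>

definition renewal_pred :: "('c list \<Rightarrow> bool) \<Rightarrow> bool" where
  "renewal_pred R \<longleftrightarrow> R [] \<and> (\<forall>xs ys. R xs \<longrightarrow> R (xs @ ys) = R ys)"

lemma measurable_map_upt:
  fixes \<xi> :: "'a \<Rightarrow> nat \<Rightarrow> 'c :: countable"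
  assumes "\<And>n. (\<lambda>\<omega>. \<xi> \<omega> n) \<in> measurable M (count_space UNIV)"
  shows "(\<lambda>\<omega>. map (\<xi> \<omega>) [0..<n]) \<in> measurable M (count_space UNIV)"
proof (subst measurable_count_space_eq2_countable, intro conjI ballI)
  fix xs :: "'c list"
  have [measurable]: "(\<lambda>\<omega>. \<xi> \<omega> i) \<in> measurable M (count_space UNIV)" for i
    by (rule assms)
  have eq: "map (\<xi> \<omega>) [0..<n] = xs \<longleftrightarrow> length xs = n \<and> (\<forall>i<n. \<xi> \<omega> i = xs ! i)" for \<omega>
    unfolding list_eq_iff_nth_eq by (rule iffI; simp)
  have "(\<lambda>\<omega>. map (\<xi> \<omega>) [0..<n]) -` {xs} \<inter> space M =
     {\<omega>\<in>space M. length xs = n \<and> (\<forall>i<n. \<xi> \<omega> i = xs ! i)}"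
    unfolding eq[symmetric] by (rule set_eqI) (simp add: conj_commute)
  also have "\<dots> \<in> sets M"
    by measurable
  finally show "(\<lambda>\<omega>. map (\<xi> \<omega>) [0..<n]) -` {xs} \<inter> space M \<in> sets M" .
qed auto

text \<open>Split by the last occurrence up to time \<open>K\<close>: these disjoint events have
  probabilities \<open>u n * q (K - n)\<close>, and \<open>q\<close> is non-increasing, so
  \<open>q K * (\<Sum>n<K. u n) \<le> 1\<close>. As the sums diverge, \<open>q\<close> tends to 0,
  and so a given occurrence is the last one with probability 0. Only the laws of finite initial
  segments enter.\<close>

lemma (in prob_space) renewal_infinitely_often:
  fixes \<xi> :: "'a \<Rightarrow> nat \<Rightarrow> 'c :: countable"
  assumes meas: "\<And>n. (\<lambda>\<omega>. \<xi> \<omega> n) \<in> measurable M (count_space UNIV)"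
    and law: "\<And>n. distr M (count_space UNIV) (\<lambda>\<omega>. map (\<xi> \<omega>) [0..<n]) = measure_pmf (replicate_pmf n p)"
    and ren: "renewal_pred R"
    and div: "\<And>B :: real. \<exists>N. B < (\<Sum>n<N. measure (replicate_pmf n p) {xs. R xs})"
  shows "AE \<omega> in M. \<exists>\<^sub>\<infinity>n. R (map (\<xi> \<omega>) [0..<n])"
proof -
  define u where "u n = measure (replicate_pmf n p) {xs. R xs}" for n
  define q where "q n = measure (replicate_pmf n p) {xs. \<forall>k. 0 < k \<and> k \<le> n \<longrightarrow> \<not> R (take k xs)}" for n
  have R_append: "R xs \<Longrightarrow> R (xs @ ys) = R ys" for xs ys
    using ren by (auto simp: renewal_pred_def)
  let ?last = "\<lambda>K n. {zs. R (take n zs) \<and> (\<forall>k. n < k \<and> k \<le> K \<longrightarrow> \<not> R (take k zs))}"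
  have last_eq: "measure (replicate_pmf (n + m) p) (?last (n + m) n) = u n * q m" for n m
  proof -
    have "?last (n + m) n =
       {zs. R (take n zs) \<and> (\<forall>k. 0 < k \<and> k \<le> m \<longrightarrow> \<not> R (take k (drop n zs)))}"
    proof (intro Collect_cong conj_cong refl iffI allI impI)
      fix zs k assume 1: "R (take n zs)" "\<forall>k. n < k \<and> k \<le> n + m \<longrightarrow> \<not> R (take k zs)" "0 < k \<and> k \<le> m"
      then show "\<not> R (take k (drop n zs))"
        using R_append[of "take n zs" "take k (drop n zs)"] 1(2)[rule_format, of "n + k"]
        by (simp add: take_add)
    next
      fix zs k assume 1: "R (take n zs)" "\<forall>k. 0 < k \<and> k \<le> m \<longrightarrow> \<not> R (take k (drop n zs))" "n < k \<and> k \<le> n + m"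
      then show "\<not> R (take k zs)"
        using R_append[of "take n zs" "take (k - n) (drop n zs)"] 1(2)[THEN spec, of "k - n"]
          take_add[of n "k - n" zs] by auto
    qed
    then show ?thesis
      unfolding u_def q_def by (simp only: replicate_pmf_take_drop[where P = R and Q = "\<lambda>ys. \<forall>k. 0 < k \<and> k \<le> m \<longrightarrow> \<not> R (take k ys)"])
  qed
  have q_nonneg: "0 \<le> q n" and u_nonneg: "0 \<le> u n" and u_le: "u n \<le> 1" for n
    by (simp_all add: q_def u_def)
  have q_mono: "q (m + n) \<le> q m" for m n
  proof -
    have "q (m + n) \<le> measure (replicate_pmf (m + n) p)
       {zs. (\<forall>k. 0 < k \<and> k \<le> m \<longrightarrow> \<not> R (take k (take m zs))) \<and> True}"
      unfolding q_def by (intro measure_pmf.finite_measure_mono) (auto simp: min_def)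
    also have "\<dots> = q m * 1"
      unfolding q_def by (subst replicate_pmf_take_drop) simp
    finally show ?thesis by simp
  qed
  have q_bound: "q K * (\<Sum>n<K. u n) \<le> 1" for K
  proof -
    have "q K * (\<Sum>n<K. u n) = (\<Sum>n<K. u n * q K)"
      by (simp add: sum_distrib_left mult.commute)
    also have "\<dots> \<le> (\<Sum>n<K. measure (replicate_pmf K p) (?last K n))"
    proof (intro sum_mono)
      fix n assume "n \<in> {..<K}"
      then obtain m where K: "K = n + m" using less_imp_add_positive by auto
      show "u n * q K \<le> measure (replicate_pmf K p) (?last K n)"
        unfolding K last_eq using q_mono[of m n] u_nonneg[of n]
        by (intro mult_left_mono) (auto simp: add.commute)
    qed
    also have "\<dots> = measure (replicate_pmf K p) (\<Union>n<K. ?last K n)"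
    proof (rule measure_pmf.finite_measure_finite_Union[symmetric])
      show "disjoint_family_on (?last K) {..<K}"
        unfolding disjoint_family_on_def
        by (auto, metis less_imp_le linorder_neqE_nat)
    qed auto
    also have "\<dots> \<le> 1" by simp
    finally show ?thesis .
  qed
  have q_small: "\<exists>K. q K < e" if "e > 0" for e
  proof -
    obtain K where K: "1 / e < (\<Sum>n<K. u n)" using div[of "1 / e"] by (auto simp: u_def)
    have "q K < e"
    proof (rule ccontr)
      assume "\<not> q K < e"
      then have "e * (\<Sum>n<K. u n) \<le> q K * (\<Sum>n<K. u n)"
        by (intro mult_right_mono sum_nonneg u_nonneg) auto
      moreover have "e * (\<Sum>n<K. u n) > 1" using K that by (simp add: divide_simps mult.commute)
      ultimately show False using q_bound[of K] by linarith
    qed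
    then show ?thesis ..
  qed
  have meas_map [measurable]: "(\<lambda>\<omega>. map (\<xi> \<omega>) [0..<n]) \<in> measurable M (count_space UNIV)" for n
    by (rule measurable_map_upt) (rule meas)
  have "AE \<omega> in M. \<not> (R (map (\<xi> \<omega>) [0..<n]) \<and> (\<forall>k>n. \<not> R (map (\<xi> \<omega>) [0..<k])))" for n
  proof -
    let ?L = "{\<omega> \<in> space M. R (map (\<xi> \<omega>) [0..<n]) \<and> (\<forall>k>n. \<not> R (map (\<xi> \<omega>) [0..<k]))}"
    have L: "?L \<in> sets M" by measurable
    have prob_le: "prob ?L \<le> q K" for K
    proof -
      have "prob ?L \<le> prob ((\<lambda>\<omega>. map (\<xi> \<omega>) [0..<n + K]) -` ?last (n + K) n \<inter> space M)"
      proof (intro finite_measure_mono)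
        have "take k (map (\<xi> \<omega>) [0..<n + K]) = map (\<xi> \<omega>) [0..<k]" if "k \<le> n + K" for k \<omega>
          using that by (simp add: take_map)
        then show "?L \<subseteq> (\<lambda>\<omega>. map (\<xi> \<omega>) [0..<n + K]) -` ?last (n + K) n \<inter> space M"
          by auto
        show "(\<lambda>\<omega>. map (\<xi> \<omega>) [0..<n + K]) -` ?last (n + K) n \<inter> space M \<in> events"
          by (rule measurable_sets[OF meas_map]) simp
      qed
      also have "\<dots> = measure (distr M (count_space UNIV) (\<lambda>\<omega>. map (\<xi> \<omega>) [0..<n + K])) (?last (n + K) n)"
        by (subst measure_distr) auto
      also have "\<dots> = u n * q K" unfolding law last_eq ..
      also have "\<dots> \<le> 1 * q K" using u_le q_nonneg by (intro mult_right_mono) auto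
      finally show ?thesis by simp
    qed
    have "prob ?L = 0"
    proof (rule ccontr)
      assume "prob ?L \<noteq> 0"
      then have "prob ?L > 0" using measure_nonneg[of M ?L] by linarith
      then obtain K where "q K < prob ?L" using q_small by blast
      with prob_le[of K] show False by linarith
    qed
    then show ?thesis
      using L by (subst AE_iff_measurable[OF L]) (auto simp: emeasure_eq_measure)
  qed
  then have "AE \<omega> in M. \<forall>n. \<not> (R (map (\<xi> \<omega>) [0..<n]) \<and> (\<forall>k>n. \<not> R (map (\<xi> \<omega>) [0..<k])))"
    by (simp add: AE_all_countable)
  then show ?thesis
  proof (rule AE_mp, intro AE_I2 impI)
    fix \<omega> assume *: "\<forall>n. \<not> (R (map (\<xi> \<omega>) [0..<n]) \<and> (\<forall>k>n. \<not> R (map (\<xi> \<omega>) [0..<k])))"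
    have "\<exists>n\<ge>m. R (map (\<xi> \<omega>) [0..<n])" for m
    proof (induction m)
      case 0
      show ?case using ren by (intro exI[of _ 0]) (simp add: renewal_pred_def)
    next
      case (Suc m)
      then obtain n where "n \<ge> m" "R (map (\<xi> \<omega>) [0..<n])" by blast
      then obtain k where "k > n" "R (map (\<xi> \<omega>) [0..<k])" using * by blast
      then show ?case using \<open>n \<ge> m\<close> by (intro exI[of _ k]) simp
    qed
    then show "\<exists>\<^sub>\<infinity>n. R (map (\<xi> \<omega>) [0..<n])"
      by (simp add: INFM_nat_le)
  qed
qed

section \<open>Cut times of the walk with trees\<close>

lemma ennreal_half: "ennreal (x / 2) = inverse 2 * ennreal x"
  using ennreal_mult'[of "1 / 2" x] by simp

section \<open>The centred tree law and the law of a mark\<close>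

definition rho0 :: "ltree pmf" where
  "rho0 = embed_pmf (\<lambda>t. if well_labeled t \<and> root_label t = 0 then 1 / 2 * (1 / 12) ^ n_edges t else 0)"

lemma pmf_rho0:
  "pmf rho0 t = (if well_labeled t \<and> root_label t = 0 then 1 / 2 * (1 / 12) ^ n_edges t else 0)"
  unfolding rho0_def
proof (rule pmf_embed_pmf)
  have "(\<integral>\<^sup>+t. ennreal (if well_labeled t \<and> root_label t = 0 then 1 / 2 * (1 / 12) ^ n_edges t else 0) \<partial>count_space UNIV)
     = (\<integral>\<^sup>+t. ennreal (1 / 2) * tree_weight UNIV 0 t \<partial>count_space UNIV)"
    by (intro nn_integral_cong) (auto simp: tree_weight_def ennreal_half)
  also have "\<dots> = ennreal (1 / 2) * tree_sum UNIV 0"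
    by (simp add: nn_integral_cmult tree_sum_def)
  also have "\<dots> = 1"
    by (simp add: tree_sum_eq_val tree_val_UNIV ennreal_half[symmetric] del: ennreal_numeral)
  finally show "(\<integral>\<^sup>+t. ennreal (if well_labeled t \<and> root_label t = 0 then 1 / 2 * (1 / 12) ^ n_edges t else 0) \<partial>count_space UNIV) = 1" .
qed auto

lemma measure_rho: "measure (rho k) {t} = pmf rho0 (shift_labels (- k) t)"
  by (simp add: rho_def measure_def emeasure_density pmf_rho0 nn_integral_indicator_singleton')

lemma prob_rho0_above: "measure rho0 {t. labels_in {- int h<..} t} = pos_frac h"
proof -
  have "emeasure rho0 {t. labels_in {- int h<..} t}
     = (\<integral>\<^sup>+t. ennreal (pmf rho0 t) * indicator {t. labels_in {- int h<..} t} t \<partial>count_space UNIV)"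
    by (subst measure_pmf_eq_density) (simp add: emeasure_density)
  also have "\<dots> = (\<integral>\<^sup>+t. ennreal (1 / 2) * tree_weight {- int h<..} 0 t \<partial>count_space UNIV)"
    by (intro nn_integral_cong) (auto simp: pmf_rho0 tree_weight_def ennreal_half)
  also have "\<dots> = ennreal (1 / 2) * tree_sum {- int h<..} 0"
    by (simp add: nn_integral_cmult tree_sum_def)
  also have "tree_sum {- int h<..} 0 = tree_sum {0<..} (0 + int h)"
  proof -
    have "(\<lambda>x. x + int h) -` {0<..} = {- int h<..}" by auto
    then show ?thesis using tree_sum_shift[of "{0<..}" 0 "int h"] by simp
  qed
  also have "ennreal (1 / 2) * \<dots> = ennreal (pos_frac h)"
    by (simp add: tree_sum_eq_val tree_val_positive ennreal_half[symmetric])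
  finally show ?thesis
    by (simp add: measure_pmf.emeasure_eq_measure pos_frac_nonneg)
qed

type_synonym mark = "ltree option"

text \<open>Recording a tree relative to its root label is what allows i.i.d. marks although the
  laws of the trees vary with the bridge. \<open>None\<close> is a step without a tree. One law
  serves both reading directions because the steps are symmetric.\<close>

definition mark_pmf :: "mark pmf" where
  "mark_pmf = bind_pmf (bernoulli_pmf (1 / 2)) (\<lambda>c. if c then map_pmf Some rho0 else return_pmf None)"

lemma pmf_mark: "pmf mark_pmf x = (case x of None \<Rightarrow> 1 / 2 | Some t \<Rightarrow> pmf rho0 t / 2)"
proof -
  have "pmf (map_pmf Some rho0) None = 0"
    by (simp add: pmf_eq_0_set_pmf)
  moreover have "pmf (map_pmf Some rho0) (Some t) = pmf rho0 t" for t
    by (rule pmf_map_inj') simp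
  ultimately show ?thesis
    by (cases x) (simp_all add: mark_pmf_def pmf_bind)
qed

lemma measure_replicate_mark_Suc:
  assumes "\<And>t ys. E (Some t # ys) \<longleftrightarrow> B t \<and> E' ys"
  shows "measure (replicate_pmf (Suc n) mark_pmf) {xs. E xs} =
    (measure (replicate_pmf n mark_pmf) {ys. E (None # ys)} +
     measure rho0 {t. B t} * measure (replicate_pmf n mark_pmf) {ys. E' ys}) / 2"
proof -
  let ?P = "replicate_pmf n mark_pmf"
  have 1: "emeasure ?P {ys. E (Some t # ys)} = indicator {t. B t} t * emeasure ?P {ys. E' ys}" for t
    by (auto simp: assms indicator_def)
  have 2: "(\<integral>\<^sup>+ys. indicator {xs. E xs} (x # ys) \<partial>?P) = emeasure ?P {ys. E (x # ys)}" for x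
  proof -
    have "(\<lambda>ys. indicator {xs. E xs} (x # ys)) = (indicator {ys. E (x # ys)} :: _ \<Rightarrow> ennreal)"
      by (auto simp: indicator_def)
    then show ?thesis by (simp only: nn_integral_indicator sets_measure_pmf UNIV_I)
  qed
  have "emeasure (replicate_pmf (Suc n) mark_pmf) {xs. E xs} =
      (\<integral>\<^sup>+x. emeasure ?P {ys. E (x # ys)} \<partial>mark_pmf)"
    by (simp add: 2)
  also have "\<dots> = (\<integral>\<^sup>+t. emeasure ?P {ys. E (Some t # ys)} \<partial>rho0) * ennreal (1 / 2)
     + emeasure ?P {ys. E (None # ys)} * ennreal (1 / 2)"
    unfolding mark_pmf_def by (simp add: nn_integral_bernoulli_pmf)
  also have "(\<integral>\<^sup>+t. emeasure ?P {ys. E (Some t # ys)} \<partial>rho0) = emeasure rho0 {t. B t} * emeasure ?P {ys. E' ys}"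
    unfolding 1 by (simp add: nn_integral_multc)
  also have "emeasure rho0 {t. B t} * emeasure ?P {ys. E' ys} * ennreal (1 / 2)
     + emeasure ?P {ys. E (None # ys)} * ennreal (1 / 2) =
     ennreal ((measure ?P {ys. E (None # ys)} + measure rho0 {t. B t} * measure ?P {ys. E' ys}) / 2)"
    by (simp add: measure_pmf.emeasure_eq_measure ennreal_mult''[symmetric] add_divide_distrib add.commute ennreal_half mult.commute[of _ "inverse 2"])
  finally show ?thesis
    by (simp add: measure_pmf.emeasure_eq_measure)
qed

section \<open>Cuts as renewal events\<close>

fun mark_step :: "int \<Rightarrow> mark \<Rightarrow> int" where
  "mark_step \<sigma> None = - \<sigma>"
| "mark_step \<sigma> (Some t) = \<sigma>"

definition disp :: "int \<Rightarrow> mark list \<Rightarrow> int" where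
  "disp \<sigma> xs = sum_list (map (mark_step \<sigma>) xs)"

lemma disp_simps [simp]:
  "disp \<sigma> [] = 0" "disp \<sigma> (x # xs) = mark_step \<sigma> x + disp \<sigma> xs"
  "disp \<sigma> (xs @ ys) = disp \<sigma> xs + disp \<sigma> ys"
  by (simp_all add: disp_def)

text \<open>The walk starts at height \<open>h\<close> and steps by \<open>\<sigma>\<close> at a mark that carries a tree, whose labels are
  shifted by the upper end of the step.\<close>

fun stays_above :: "int \<Rightarrow> int \<Rightarrow> mark list \<Rightarrow> bool" where
  "stays_above \<sigma> h [] \<longleftrightarrow> 0 \<le> h"
| "stays_above \<sigma> h (None # xs) \<longleftrightarrow> 0 \<le> h \<and> stays_above \<sigma> (h - \<sigma>) xs"
| "stays_above \<sigma> h (Some t # xs) \<longleftrightarrow>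
     0 \<le> h \<and> labels_in {- max h (h + \<sigma>)<..} t \<and> stays_above \<sigma> (h + \<sigma>) xs"

lemma stays_above_nonneg: "stays_above \<sigma> h xs \<Longrightarrow> 0 \<le> h"
  by (induction \<sigma> h xs rule: stays_above.induct) auto

lemma stays_above_append:
  "stays_above \<sigma> h (xs @ ys) \<longleftrightarrow> stays_above \<sigma> h xs \<and> stays_above \<sigma> (h + disp \<sigma> xs) ys"
proof (induction xs arbitrary: h)
  case Nil
  show ?case by (auto dest: stays_above_nonneg)
next
  case (Cons x xs)
  then show ?case by (cases x) (simp_all add: algebra_simps)
qed

lemma stays_above_mono: "stays_above \<sigma> h xs \<Longrightarrow> h \<le> h' \<Longrightarrow> stays_above \<sigma> h' xs"
proof (induction xs arbitrary: h h')
  case (Cons x xs)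
  show ?case
  proof (cases x)
    case None
    then show ?thesis using Cons.prems Cons.IH[of "h - \<sigma>" "h' - \<sigma>"] by simp
  next
    case (Some t)
    have "max h (h + \<sigma>) \<le> max h' (h' + \<sigma>)" using Cons.prems by (intro max.mono) auto
    moreover have "labels_in {- max h (h + \<sigma>)<..} t" using Some Cons.prems by simp
    ultimately have "labels_in {- max h' (h' + \<sigma>)<..} t"
      using labels_in_mono greaterThan_subset_iff by (metis neg_le_iff_le)
    then show ?thesis using Some Cons.prems Cons.IH[of "h + \<sigma>" "h' + \<sigma>"] by simp
  qed
qed simp

lemma stays_above_nth:
  assumes "stays_above \<sigma> h xs" "n < length xs" "xs ! n = Some t"
  shows "labels_in {- max (h + disp \<sigma> (take n xs)) (h + disp \<sigma> (take n xs) + \<sigma>)<..} t"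
  using assms(1) assms(3) id_take_nth_drop[OF assms(2)]
    stays_above_append[of \<sigma> h "take n xs" "xs ! n # drop (Suc n) xs"] by auto

text \<open>Started at \<open>- disp \<sigma> xs\<close> the walk ends at 0, so heights are relative
  to the final value: a cut is a weak minimum of the walk that all earlier trees exceed
  strictly.\<close>

definition cut :: "int \<Rightarrow> mark list \<Rightarrow> bool" where
  "cut \<sigma> xs \<longleftrightarrow> stays_above \<sigma> (- disp \<sigma> xs) xs"

text \<open>After a cut, everything read so far lies above the current level. A cut of the remaining
  marks ends at or below this level, so by monotonicity in the height the earlier marks impose no
  further condition.\<close>

lemma renewal_cut: "renewal_pred (cut \<sigma>)"
  unfolding renewal_pred_def cut_def
proof (intro conjI allI impI)
  fix xs ys assume xs: "stays_above \<sigma> (- disp \<sigma> xs) xs"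
  have "stays_above \<sigma> (- disp \<sigma> (xs @ ys)) xs" if "stays_above \<sigma> (- disp \<sigma> ys) ys"
    using xs stays_above_nonneg[OF that] by (auto intro: stays_above_mono)
  then show "stays_above \<sigma> (- disp \<sigma> (xs @ ys)) (xs @ ys) = stays_above \<sigma> (- disp \<sigma> ys) ys"
    by (auto simp: stays_above_append)
qed auto

text \<open>Conditioning on the first mark reproduces the recursion of \<open>walk_weight\<close>:
  for \<open>\<sigma> = - 1\<close> a tree belongs to a down-step and has its root at the starting
  height of the step.\<close>

lemma measure_stays_above_right:
  "measure (replicate_pmf n mark_pmf) {xs. stays_above (- 1) (int h) xs \<and> int h + disp (- 1) xs = 0} = walk_weight n h"
proof (induction n arbitrary: h)
  case 0
  then show ?case by (simp add: indicator_def)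
next
  case (Suc n)
  let ?P = "replicate_pmf n mark_pmf"
  let ?E = "\<lambda>h xs. stays_above (- 1) h xs \<and> h + disp (- 1) xs = 0"
  have "measure (replicate_pmf (Suc n) mark_pmf) {xs. ?E (int h) xs} =
     (measure ?P {ys. ?E (int h) (None # ys)} +
      measure rho0 {t. labels_in {- int h<..} t} * measure ?P {ys. ?E (int h - 1) ys}) / 2"
    by (rule measure_replicate_mark_Suc) (auto simp: max_def)
  also have "{ys. ?E (int h) (None # ys)} = {ys. ?E (int (Suc h)) ys}"
    by (auto simp: algebra_simps)
  also have "measure rho0 {t. labels_in {- int h<..} t} * measure ?P {ys. ?E (int h - 1) ys}
     = pos_frac h * walk_weight n (h - 1)"
  proof (cases h)
    case 0
    then show ?thesis by (simp only: prob_rho0_above) (simp add: pos_frac_def)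
  next
    case (Suc k)
    then show ?thesis using Suc.IH[of k] by (simp only: prob_rho0_above) simp
  qed
  finally show ?case using Suc[of "Suc h"] by simp
qed

text \<open>For \<open>\<sigma> = 1\<close> a tree belongs to an up-step and has its root at the
  arrival height. A path from \<open>h\<close> to 0 crosses each of the \<open>h\<close> lowest
  levels once more downwards than upwards, so the product over these levels turns the factors of the
  up-steps into the same factors for the down-steps.\<close>

lemma measure_stays_above_left:
  "measure (replicate_pmf n mark_pmf) {xs. stays_above 1 (int h) xs \<and> int h + disp 1 xs = 0}
     * (\<Prod>r\<in>{1..h}. pos_frac r) = walk_weight n h"
proof (induction n arbitrary: h)
  case 0
  then show ?case by (cases "h = 0") (simp_all add: indicator_def)
next
  case (Suc n)
  let ?P = "replicate_pmf n mark_pmf"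
  let ?E = "\<lambda>h xs. stays_above 1 h xs \<and> h + disp 1 xs = 0"
  let ?W = "\<lambda>h. \<Prod>r\<in>{1..h}. pos_frac r"
  have "measure (replicate_pmf (Suc n) mark_pmf) {xs. ?E (int h) xs} =
     (measure ?P {ys. ?E (int h) (None # ys)} +
      measure rho0 {t. labels_in {- int (Suc h)<..} t} * measure ?P {ys. ?E (int (Suc h)) ys}) / 2"
    by (rule measure_replicate_mark_Suc) (auto simp: max_def add.commute algebra_simps)
  also have "{ys. ?E (int h) (None # ys)} = {ys. ?E (int h - 1) ys}"
    using stays_above_nonneg by force
  finally have step: "measure (replicate_pmf (Suc n) mark_pmf) {xs. ?E (int h) xs} =
     (measure ?P {ys. ?E (int h - 1) ys} + pos_frac (Suc h) * measure ?P {ys. ?E (int (Suc h)) ys}) / 2"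
    unfolding prob_rho0_above .
  have ring: "(x + c * y) / 2 * w = (x * w + y * (c * w)) / 2" for x y c w :: real
    by (simp add: algebra_simps)
  have "?W (Suc h) = pos_frac (Suc h) * ?W h" by simp
  then have "measure (replicate_pmf (Suc n) mark_pmf) {xs. ?E (int h) xs} * ?W h =
     (measure ?P {ys. ?E (int h - 1) ys} * ?W h + measure ?P {ys. ?E (int (Suc h)) ys} * ?W (Suc h)) / 2"
    by (simp only: step ring)
  also have "measure ?P {ys. ?E (int h - 1) ys} * ?W h = pos_frac h * walk_weight n (h - 1)"
  proof (cases h)
    case 0
    have "\<not> stays_above 1 (- 1) ys" for ys
      using stays_above_nonneg[of 1 "- 1" ys] by auto
    with 0 show ?thesis by (simp add: pos_frac_def)
  next
    case (Suc k)
    then show ?thesis using Suc.IH[of k] by (simp add: algebra_simps)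
  qed
  finally show ?case using Suc[of "Suc h"] by simp
qed

lemma measure_stays_above_ge:
  assumes "\<sigma> = 1 \<or> \<sigma> = - 1"
  shows "measure (replicate_pmf n mark_pmf) {xs. stays_above \<sigma> (int h) xs \<and> int h + disp \<sigma> xs = 0} \<ge> walk_weight n h"
proof (cases "\<sigma> = 1")
  case True
  have "(\<Prod>r\<in>{1..h}. pos_frac r) \<le> 1"
    by (intro prod_le_1) (auto simp: pos_frac_nonneg pos_frac_le_1)
  then show ?thesis
    using measure_stays_above_left[of n h] True
      mult_left_mono[of "\<Prod>r\<in>{1..h}. pos_frac r" 1] by (metis measure_nonneg mult.right_neutral)
next
  case False
  then show ?thesis using assms measure_stays_above_right[of n h] by simp
qed

lemma cut_diverges:
  assumes "\<sigma> = 1 \<or> \<sigma> = - 1"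
  shows "\<exists>N. (B :: real) < (\<Sum>n<N. measure (replicate_pmf n mark_pmf) {xs. cut \<sigma> xs})"
proof -
  obtain H N where HN: "B < (\<Sum>h<H. \<Sum>n<N. walk_weight n h)"
    using walk_weight_unbounded by blast
  have "(\<Sum>h<H. \<Sum>n<N. walk_weight n h) = (\<Sum>n<N. \<Sum>h<H. walk_weight n h)"
    by (rule sum.swap)
  also have "\<dots> \<le> (\<Sum>n<N. measure (replicate_pmf n mark_pmf) {xs. cut \<sigma> xs})"
  proof (intro sum_mono)
    fix n
    \<comment> \<open>Cuts are sorted by the starting height relative to their end; different
      heights give disjoint events.\<close>
    let ?A = "\<lambda>h. {xs. stays_above \<sigma> (int h) xs \<and> int h + disp \<sigma> xs = 0}"
    have "(\<Sum>h<H. walk_weight n h) \<le> (\<Sum>h<H. measure (replicate_pmf n mark_pmf) (?A h))"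
      by (intro sum_mono measure_stays_above_ge assms)
    also have "\<dots> = measure (replicate_pmf n mark_pmf) (\<Union>h<H. ?A h)"
      by (intro measure_pmf.finite_measure_finite_Union[symmetric]) (auto simp: disjoint_family_on_def)
    also have "\<dots> \<le> measure (replicate_pmf n mark_pmf) {xs. cut \<sigma> xs}"
    proof (rule measure_pmf.finite_measure_mono)
      show "(\<Union>h<H. ?A h) \<subseteq> {xs. cut \<sigma> xs}"
        unfolding cut_def by (auto simp: eq_neg_iff_add_eq_0[symmetric])
    qed simp
    finally show "(\<Sum>h<H. walk_weight n h) \<le> measure (replicate_pmf n mark_pmf) {xs. cut \<sigma> xs}" .
  qed
  finally show ?thesis using HN by (intro exI[of _ N]) linarith
qed

definition ends_in_tree :: "(mark list \<Rightarrow> bool) \<Rightarrow> ltree set \<Rightarrow> mark list \<Rightarrow> bool" where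
  "ends_in_tree R A xs \<longleftrightarrow> xs = [] \<or> (\<exists>ys t. xs = ys @ [Some t] \<and> R ys \<and> t \<in> A)"

lemma renewal_ends_in_tree:
  assumes R: "renewal_pred R" and A: "\<And>t. t \<in> A \<Longrightarrow> R [Some t]"
  shows "renewal_pred (ends_in_tree R A)"
  unfolding renewal_pred_def
proof (intro conjI allI impI)
  fix xs ys assume xs: "ends_in_tree R A xs"
  then have "R xs" using R A by (auto simp: ends_in_tree_def renewal_pred_def)
  show "ends_in_tree R A (xs @ ys) = ends_in_tree R A ys"
  proof (cases ys rule: rev_cases)
    case (snoc zs x)
    then show ?thesis
      using R \<open>R xs\<close> by (auto simp: ends_in_tree_def renewal_pred_def simp flip: append_assoc)
  qed (use xs in \<open>simp add: ends_in_tree_def\<close>)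
qed (simp add: ends_in_tree_def)

text \<open>One further mark with a tree from \<open>A\<close> costs the constant factor
  \<open>measure rho0 A / 2\<close>, which does not affect divergence.\<close>

lemma ends_in_tree_diverges:
  assumes div: "\<And>B :: real. \<exists>N. B < (\<Sum>n<N. measure (replicate_pmf n mark_pmf) {xs. R xs})"
    and A: "measure rho0 A > 0"
  shows "\<exists>N. (B :: real) < (\<Sum>n<N. measure (replicate_pmf n mark_pmf) {xs. ends_in_tree R A xs})"
proof -
  define c where "c = measure rho0 A / 2"
  have "c > 0" using A by (simp add: c_def)
  let ?P = "\<lambda>n. replicate_pmf n mark_pmf"
  have ge: "measure (?P (Suc n)) {xs. ends_in_tree R A xs} \<ge> measure (?P n) {xs. R xs} * c" for n
  proof -
    have "measure (?P (Suc 0)) {ys. \<exists>t. ys = [Some t] \<and> t \<in> A} = c"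
      by (subst measure_replicate_mark_Suc[where B = "\<lambda>t. t \<in> A" and E' = "\<lambda>ys. ys = []"])
         (auto simp: c_def)
    then have "measure (?P n) {xs. R xs} * c =
        measure (?P (n + Suc 0)) {zs. R (take n zs) \<and> (\<exists>t. drop n zs = [Some t] \<and> t \<in> A)}"
      by (subst replicate_pmf_take_drop) simp
    also have "\<dots> \<le> measure (?P (n + Suc 0)) {xs. ends_in_tree R A xs}"
      by (intro measure_pmf.finite_measure_mono)
         (auto simp: ends_in_tree_def, metis append_take_drop_id)
    finally show ?thesis by simp
  qed
  obtain N where N: "B / c < (\<Sum>n<N. measure (?P n) {xs. R xs})" using div by blast
  have "B < (\<Sum>n<N. measure (?P n) {xs. R xs}) * c"
    using N \<open>c > 0\<close> by (simp add: divide_simps)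
  also have "\<dots> \<le> (\<Sum>n<N. measure (?P (Suc n)) {xs. ends_in_tree R A xs})"
    unfolding sum_distrib_right by (intro sum_mono ge)
  also have "\<dots> \<le> (\<Sum>n<Suc N. measure (?P n) {xs. ends_in_tree R A xs})"
    by (subst sum.lessThan_Suc_shift) simp
  finally show ?thesis ..
qed

section \<open>The bridge read as independent marks\<close>

lemma pmf_replicate_pmf:
  "pmf (replicate_pmf n p) xs = (if length xs = n then \<Prod>i<n. pmf p (xs ! i) else 0)"
proof (induction n arbitrary: xs)
  case 0
  show ?case by (simp add: pmf_return)
next
  case (Suc n)
  have eq: "replicate_pmf (Suc n) p = map_pmf (\<lambda>(x, xs). x # xs) (pair_pmf p (replicate_pmf n p))"
    by (simp add: pair_pmf_def map_bind_pmf)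
  show ?case
  proof (cases xs)
    case Nil
    then have "xs \<notin> set_pmf (replicate_pmf (Suc n) p)"
      by (simp only: set_replicate_pmf) simp
    with Nil show ?thesis by (simp add: pmf_eq_0_set_pmf del: replicate_pmf.simps)
  next
    case (Cons y ys)
    have "pmf (replicate_pmf (Suc n) p) ((\<lambda>(x, xs). x # xs) (y, ys)) = pmf p y * pmf (replicate_pmf n p) ys"
      unfolding eq by (subst pmf_map_inj') (auto simp: inj_def pmf_pair)
    then show ?thesis
      using Suc.IH[of ys] by (simp add: Cons prod.lessThan_Suc_shift del: replicate_pmf.simps prod.lessThan_Suc)
  qed
qed

text \<open>The right half of the bridge is read with \<open>\<sigma> = - 1\<close>, the left half, from \<open>0\<close> to the left, with
  \<open>\<sigma> = 1\<close>: the \<open>n\<close>-th step then carries a tree iff it is equal to \<open>\<sigma>\<close>, and the tree is grafted at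
  \<open>mark_index \<sigma> n\<close>, the left end of the step.\<close>

definition mark_index :: "int \<Rightarrow> nat \<Rightarrow> int" where
  "mark_index \<sigma> n = (if \<sigma> = 1 then - int n - 1 else int n)"

definition mark_at :: "int \<Rightarrow> (int \<Rightarrow> int) \<Rightarrow> (int \<Rightarrow> ltree) \<Rightarrow> nat \<Rightarrow> mark" where
  "mark_at \<sigma> b T n = (let i = mark_index \<sigma> n
     in if i \<in> DS b then Some (shift_labels (- b i) (T i)) else None)"

lemma inj_mark_index: "inj (mark_index \<sigma>)"
  by (auto simp: inj_def mark_index_def)

lemma left_neighbour: "- 1 - int n = - int n - 1"
  by simp

lemma mark_index_in_DS:
  assumes "\<sigma> = 1 \<or> \<sigma> = - 1"
  shows "mark_index \<sigma> n \<in> DS b \<longleftrightarrow> b (- \<sigma> * int (Suc n)) - b (- \<sigma> * int n) = \<sigma>"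
  using assms by (auto simp: mark_index_def DS_def left_neighbour add.commute[of 1])

lemma b_mark_index:
  assumes "\<sigma> = 1 \<or> \<sigma> = - 1" "mark_index \<sigma> n \<in> DS b"
  shows "b (mark_index \<sigma> n) = max (b (- \<sigma> * int n)) (b (- \<sigma> * int n) + \<sigma>)"
  using assms by (auto simp: mark_index_def DS_def algebra_simps)

definition pm_steps :: "(int \<Rightarrow> int) \<Rightarrow> bool" where
  "pm_steps b \<longleftrightarrow> b 0 = 0 \<and> (\<forall>i. \<bar>b (i + 1) - b i\<bar> = 1)"

lemma mark_step_mark_at:
  assumes "\<sigma> = 1 \<or> \<sigma> = - 1" "pm_steps b"
  shows "mark_step \<sigma> (mark_at \<sigma> b T n) = b (- \<sigma> * int (Suc n)) - b (- \<sigma> * int n)"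
proof -
  have "\<bar>b (int n + 1) - b (int n)\<bar> = 1" "\<bar>b (- int n - 1 + 1) - b (- int n - 1)\<bar> = 1"
    using assms(2) unfolding pm_steps_def by blast+
  then show ?thesis
    using assms(1) by (auto simp: mark_at_def mark_index_def DS_def left_neighbour add.commute[of 1] Let_def)
qed

lemma disp_mark_at:
  assumes "\<sigma> = 1 \<or> \<sigma> = - 1" "pm_steps b"
  shows "disp \<sigma> (map (mark_at \<sigma> b T) [0..<n]) = b (- \<sigma> * int n)"
proof (induction n)
  case 0
  show ?case using assms(2) by (simp add: pm_steps_def)
next
  case (Suc n)
  then show ?case using mark_step_mark_at[OF assms, of T n] by simp
qed

definition good_trees :: "(int \<Rightarrow> int) \<Rightarrow> (int \<Rightarrow> ltree) \<Rightarrow> bool" where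
  "good_trees b T \<longleftrightarrow> (\<forall>i\<in>DS b. well_labeled (T i) \<and> root_label (T i) = b i)"

section \<open>The law of the marks of a random treed bridge\<close>

context uniform_infinite_treed_bridge
begin

lemma walk_side:
  assumes "\<sigma> = 1 \<or> \<sigma> = - 1"
  shows "simple_random_walk (\<lambda>n \<omega>. b \<omega> (- \<sigma> * int n))"
  using assms walk_left walk_right by auto

lemma AE_pm_steps: "AE \<omega> in M. pm_steps (b \<omega>)"
proof -
  have inc: "AE \<omega> in M. \<forall>n. \<bar>X (Suc n) \<omega> - X n \<omega>\<bar> = 1"
    if X: "simple_random_walk X" and meas: "\<And>n. X n \<in> measurable M (count_space UNIV)" for X :: "nat \<Rightarrow> 'w \<Rightarrow> int"
  proof (subst AE_all_countable, rule allI)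
    fix n
    have [measurable]: "(\<lambda>\<omega>. X (Suc n) \<omega> - X n \<omega>) \<in> measurable M (count_space UNIV)"
      using meas by measurable
    have distr: "distr M (count_space UNIV) (\<lambda>\<omega>. X (Suc n) \<omega> - X n \<omega>) = measure_pmf (pmf_of_set {- 1, 1})"
      using X unfolding simple_random_walk_def by blast
    have "AE x in distr M (count_space UNIV) (\<lambda>\<omega>. X (Suc n) \<omega> - X n \<omega>). \<bar>x\<bar> = 1"
      unfolding distr by (rule AE_pmfI) auto
    then show "AE \<omega> in M. \<bar>X (Suc n) \<omega> - X n \<omega>\<bar> = 1"
      by (subst (asm) AE_distr_iff) auto
  qed
  have "AE \<omega> in M. \<forall>n. \<bar>b \<omega> (int (Suc n)) - b \<omega> (int n)\<bar> = 1"
    by (rule inc[OF walk_right]) (rule measurable_b)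
  moreover have "AE \<omega> in M. \<forall>n. \<bar>b \<omega> (- int (Suc n)) - b \<omega> (- int n)\<bar> = 1"
    by (rule inc[OF walk_left]) (rule measurable_b)
  moreover have "AE \<omega> in M. b \<omega> (int 0) = 0"
    using walk_right unfolding simple_random_walk_def by blast
  ultimately show ?thesis
  proof eventually_elim
    case (elim \<omega>)
    have "\<bar>b \<omega> (i + 1) - b \<omega> i\<bar> = 1" for i
    proof (cases "i \<ge> 0")
      case True
      then show ?thesis using elim(1)[rule_format, of "nat i"] by (simp add: add.commute)
    next
      case False
      then have "i + 1 = - int (nat (- i - 1))" "i = - int (Suc (nat (- i - 1)))" by auto
      then show ?thesis using elim(2)[rule_format, of "nat (- i - 1)"] by (metis abs_minus_commute)
    qed
    then show ?case using elim(3) by (simp add: pm_steps_def)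
  qed
qed

definition bridge_algebra :: "'w measure" where
  "bridge_algebra = vimage_algebra (space M) b (Pi\<^sub>M UNIV (\<lambda>_. count_space UNIV))"

lemma measurable_bridge: "(\<lambda>\<omega>. b \<omega> i) \<in> measurable bridge_algebra (count_space UNIV)"
proof -
  have "b \<in> measurable bridge_algebra (Pi\<^sub>M UNIV (\<lambda>_. count_space UNIV))"
    unfolding bridge_algebra_def by (rule measurable_vimage_algebra1) (auto simp: space_PiM)
  then show ?thesis
    by (rule measurable_compose) (rule measurable_component_singleton, simp)
qed

lemma subalgebra_bridge: "subalgebra M bridge_algebra"
proof -
  have "b \<in> measurable M (Pi\<^sub>M UNIV (\<lambda>_. count_space UNIV))"
    using measurable_PiM_single'[of UNIV "\<lambda>i \<omega>. b \<omega> i" M "\<lambda>_. count_space UNIV"] measurable_b by auto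
  then show ?thesis
    unfolding subalgebra_def bridge_algebra_def by (auto dest: sets_image_in_sets[OF refl])
qed

lemma prob_steps:
  assumes "simple_random_walk X" and s: "\<And>i. i < n \<Longrightarrow> s i = 1 \<or> s i = (- 1 :: int)"
  shows "prob {\<omega> \<in> space M. \<forall>i<n. X (Suc i) \<omega> - X i \<omega> = s i} = (1 / 2) ^ n"
proof (cases "n = 0")
  case True
  then show ?thesis by (simp add: prob_space)
next
  case False
  let ?D = "\<lambda>i \<omega>. X (Suc i) \<omega> - X i \<omega>"
  have ind: "indep_vars (\<lambda>_. count_space UNIV) ?D UNIV"
    and distr: "distr M (count_space UNIV) (?D i) = measure_pmf (pmf_of_set {- 1, 1})" for i
    using assms(1) by (auto simp: simple_random_walk_def)
  have meas: "?D i \<in> measurable M (count_space UNIV)" for i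
    using ind by (auto simp: indep_vars_def)
  have "{\<omega> \<in> space M. \<forall>i<n. ?D i \<omega> = s i} = (\<Inter>i\<in>{..<n}. ?D i -` {s i} \<inter> space M)"
    using False by auto
  also have "prob \<dots> = (\<Prod>i<n. prob (?D i -` {s i} \<inter> space M))"
    using False by (intro indep_varsD[OF ind]) auto
  also have "\<dots> = (\<Prod>i<n. 1 / 2)"
  proof (intro prod.cong refl)
    fix i assume "i \<in> {..<n}"
    have "prob (?D i -` {s i} \<inter> space M) = measure (distr M (count_space UNIV) (?D i)) {s i}"
      by (subst measure_distr[OF meas]) auto
    also have "\<dots> = pmf (pmf_of_set {- 1, 1}) (s i)"
      by (simp add: distr measure_pmf_single)
    also have "\<dots> = 1 / 2"
      using s[of i] \<open>i \<in> {..<n}\<close> by (auto simp: indicator_def)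
    finally show "prob (?D i -` {s i} \<inter> space M) = 1 / 2" .
  qed
  finally show ?thesis by simp
qed

lemma measurable_mark_at: "(\<lambda>\<omega>. mark_at \<sigma> (b \<omega>) (T \<omega>) n) \<in> measurable M (count_space UNIV)"
proof -
  let ?i = "mark_index \<sigma> n"
  have [measurable]: "(\<lambda>\<omega>. b \<omega> i) \<in> measurable M (count_space UNIV)"
    "(\<lambda>\<omega>. T \<omega> i) \<in> measurable M (count_space UNIV)" for i
    by (rule measurable_b, rule measurable_T)
  have "(\<lambda>\<omega>. (b \<omega> (?i + 1), b \<omega> ?i, T \<omega> ?i)) \<in>
      measurable M (count_space UNIV \<Otimes>\<^sub>M count_space UNIV \<Otimes>\<^sub>M count_space UNIV)"
    by measurable
  then have m: "(\<lambda>\<omega>. (b \<omega> (?i + 1), b \<omega> ?i, T \<omega> ?i)) \<in> measurable M (count_space UNIV)"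
    by (simp add: pair_measure_countable)
  have "(\<lambda>(x, y, t). if x = y - 1 then Some (shift_labels (- y) t) else None) \<in>
      measurable (count_space UNIV) (count_space UNIV)" by simp
  from measurable_compose[OF m this] show ?thesis
    by (simp add: mark_at_def DS_def Let_def)
qed

text \<open>Up to a null set the event is \<open>W \<inter> E\<close>, where \<open>W\<close>
  prescribes the steps and \<open>E\<close> the trees. On \<open>W\<close> the bridge is known at
  all indices involved, so the conditional probability of \<open>E\<close> given the bridge is a
  constant there, and the probability factorises.\<close>

lemma prob_marks:
  assumes \<sigma>: "\<sigma> = 1 \<or> \<sigma> = - 1" and n: "length ms = n"
  shows "prob {\<omega> \<in> space M. \<forall>i<n. mark_at \<sigma> (b \<omega>) (T \<omega>) i = ms ! i} = (\<Prod>i<n. pmf mark_pmf (ms ! i))"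
proof -
  have [measurable]: "(\<lambda>\<omega>. b \<omega> i) \<in> measurable M (count_space UNIV)"
    "(\<lambda>\<omega>. T \<omega> i) \<in> measurable M (count_space UNIV)"
    "(\<lambda>\<omega>. b \<omega> i) \<in> measurable bridge_algebra (count_space UNIV)" for i
    by (rule measurable_b, rule measurable_T, rule measurable_bridge)
  define X where "X i \<omega> = b \<omega> (- \<sigma> * int i)" for i \<omega>
  \<comment> \<open>All of this is read off from \<open>ms\<close>: \<open>\<beta>\<close> is the
    path of the walk, \<open>top\<close> the root label of a tree, and \<open>t\<close> the tree
    with its recentring undone.\<close>
  define \<beta> where "\<beta> i = disp \<sigma> (take i ms)" for i
  define top where "top i = max (\<beta> i) (\<beta> i + \<sigma>)" for i
  define I where "I = {i. i < n \<and> ms ! i \<noteq> None}"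
  define J where "J = mark_index \<sigma> ` I"
  define t where "t j = (let i = inv (mark_index \<sigma>) j in shift_labels (top i) (the (ms ! i)))" for j
  define W where "W = {\<omega> \<in> space M. X 0 \<omega> = 0 \<and> (\<forall>i<n. X (Suc i) \<omega> - X i \<omega> = mark_step \<sigma> (ms ! i))}"
  define E where "E = {\<omega> \<in> space M. \<forall>j\<in>J. j \<in> DS (b \<omega>) \<and> T \<omega> j = t j}"
  define c where "c = (\<Prod>i\<in>I. pmf rho0 (the (ms ! i)))"
  have walk: "simple_random_walk X"
    using walk_side[OF \<sigma>] by (simp add: X_def[abs_def])
  have fin: "finite I" "finite J" by (auto simp: I_def J_def)
  have W_bridge: "W \<in> sets bridge_algebra"
  proof -
    have "W = {\<omega> \<in> space bridge_algebra. X 0 \<omega> = 0 \<and> (\<forall>i<n. X (Suc i) \<omega> - X i \<omega> = mark_step \<sigma> (ms ! i))}"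
      by (simp add: W_def bridge_algebra_def)
    also have "\<dots> \<in> sets bridge_algebra" unfolding X_def by measurable
    finally show ?thesis .
  qed
  then have W_sets: "W \<in> events" using subalgebra_bridge by (auto simp: subalgebra_def)
  have E_sets: "E \<in> events"
    unfolding E_def DS_def mem_Collect_eq using fin(2) by measurable
  have on_W: "i \<le> n \<longrightarrow> X i \<omega> = \<beta> i" if "\<omega> \<in> W" for i \<omega>
  proof (induction i)
    case 0
    show ?case using that by (simp add: W_def \<beta>_def)
  next
    case (Suc i)
    show ?case
    proof
      assume "Suc i \<le> n"
      then have "X (Suc i) \<omega> - X i \<omega> = mark_step \<sigma> (ms ! i)"
        using that by (auto simp: W_def)
      moreover have "X i \<omega> = \<beta> i"
        using Suc \<open>Suc i \<le> n\<close> by simp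
      ultimately show "X (Suc i) \<omega> = \<beta> (Suc i)"
        using \<open>Suc i \<le> n\<close> n by (simp add: \<beta>_def take_Suc_conv_app_nth)
    qed
  qed
  have DS_W: "mark_index \<sigma> i \<in> DS (b \<omega>) \<longleftrightarrow> ms ! i \<noteq> None" if "\<omega> \<in> W" "i < n" for i \<omega>
    using that \<sigma> unfolding mark_index_in_DS[OF \<sigma>] by (cases "ms ! i") (auto simp: W_def X_def)
  have top_W: "b \<omega> (mark_index \<sigma> i) = top i" if "\<omega> \<in> W" "i \<in> I" for i \<omega>
  proof -
    have "mark_index \<sigma> i \<in> DS (b \<omega>)" using DS_W that by (auto simp: I_def)
    from b_mark_index[OF \<sigma> this] show ?thesis
      using on_W[OF that(1), of i] that(2) by (simp add: top_def X_def I_def)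
  qed
  have t_index: "t (mark_index \<sigma> i) = shift_labels (top i) (the (ms ! i))" for i
    by (simp add: t_def inj_mark_index)
  have marks_iff: "(\<forall>i<n. mark_at \<sigma> (b \<omega>) (T \<omega>) i = ms ! i) \<longleftrightarrow> \<omega> \<in> W \<inter> E"
    if \<omega>: "\<omega> \<in> space M" "pm_steps (b \<omega>)" for \<omega>
  proof
    assume marks: "\<forall>i<n. mark_at \<sigma> (b \<omega>) (T \<omega>) i = ms ! i"
    have "X (Suc i) \<omega> - X i \<omega> = mark_step \<sigma> (ms ! i)" if "i < n" for i
      using mark_step_mark_at[OF \<sigma> \<omega>(2), of "T \<omega>" i] marks that by (simp add: X_def)
    then have W: "\<omega> \<in> W" using \<omega> by (simp add: W_def X_def pm_steps_def)
    have "mark_index \<sigma> i \<in> DS (b \<omega>) \<and> T \<omega> (mark_index \<sigma> i) = t (mark_index \<sigma> i)" if "i \<in> I" for i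
    proof -
      have i: "i < n" "ms ! i \<noteq> None" using that by (auto simp: I_def)
      then have DS: "mark_index \<sigma> i \<in> DS (b \<omega>)" using DS_W[OF W] by blast
      then have "ms ! i = Some (shift_labels (- top i) (T \<omega> (mark_index \<sigma> i)))"
        using marks i top_W[OF W that] by (auto simp: mark_at_def Let_def)
      then show ?thesis using DS by (simp add: t_index shift_labels_shift_labels)
    qed
    then show "\<omega> \<in> W \<inter> E" using W \<omega> by (auto simp: E_def J_def)
  next
    assume WE: "\<omega> \<in> W \<inter> E"
    show "\<forall>i<n. mark_at \<sigma> (b \<omega>) (T \<omega>) i = ms ! i"
    proof (intro allI impI)
      fix i assume "i < n"
      show "mark_at \<sigma> (b \<omega>) (T \<omega>) i = ms ! i"
      proof (cases "ms ! i")
        case None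
        then show ?thesis using DS_W[of \<omega> i] WE \<open>i < n\<close> by (simp add: mark_at_def Let_def)
      next
        case (Some s)
        then have "i \<in> I" using \<open>i < n\<close> by (simp add: I_def)
        moreover from this have "T \<omega> (mark_index \<sigma> i) = t (mark_index \<sigma> i)"
          using WE by (auto simp: E_def J_def)
        ultimately show ?thesis
          using DS_W[of \<omega> i] WE \<open>i < n\<close> top_W[of \<omega> i] Some
          by (simp add: mark_at_def Let_def t_index shift_labels_shift_labels)
      qed
    qed
  qed
  have cond: "AE \<omega> in M. \<omega> \<in> W \<longrightarrow> real_cond_exp M bridge_algebra (indicator E) \<omega> = c"
    using trees_given_bridge[OF fin(2), of t] unfolding bridge_algebra_def[symmetric] E_def[symmetric]
  proof eventually_elim
    case (elim \<omega>)
    show ?case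
    proof
      assume W: "\<omega> \<in> W"
      then have "J \<subseteq> DS (b \<omega>)" using DS_W by (auto simp: J_def I_def)
      moreover have "(\<Prod>j\<in>J. measure (rho (b \<omega> j)) {t j}) = c"
        unfolding J_def c_def
        by (subst prod.reindex)
           (auto intro: inj_on_subset[OF inj_mark_index] intro!: prod.cong
             simp: top_W[OF W] t_index measure_rho shift_labels_shift_labels)
      ultimately show "real_cond_exp M bridge_algebra (indicator E) \<omega> = c" using elim by simp
    qed
  qed
  interpret B: sigma_finite_subalgebra M bridge_algebra
    by (rule finite_measure_subalgebra_is_sigma_finite)
       (auto simp: finite_measure_subalgebra_def finite_measure_subalgebra_axioms_def
         finite_measure_axioms subalgebra_bridge)
  have "prob (W \<inter> E) = (\<integral>\<omega>. indicator W \<omega> * indicator E \<omega> \<partial>M)"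
    using W_sets E_sets by (simp add: indicator_inter_arith[symmetric])
  also have "\<dots> = (\<integral>\<omega>\<in>W. indicator E \<omega> \<partial>M)"
    by (simp add: set_lebesgue_integral_def)
  \<comment> \<open>This is the defining property of the conditional expectation, for the
    bridge-measurable set \<open>W\<close>.\<close>
  also have "\<dots> = (\<integral>\<omega>\<in>W. real_cond_exp M bridge_algebra (indicator E) \<omega> \<partial>M)"
    using E_sets by (intro B.real_cond_exp_intA W_bridge) (auto simp: integrable_indicator_iff emeasure_eq_measure)
  also have "\<dots> = (\<integral>\<omega>\<in>W. c \<partial>M)"
    unfolding set_lebesgue_integral_def using cond W_sets
    by (intro integral_cong_AE) (auto elim!: eventually_mono simp: indicator_def)
  also have "\<dots> = prob W * c"
    using W_sets by (simp add: set_lebesgue_integral_def)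
  also have "prob W = prob {\<omega> \<in> space M. \<forall>i<n. X (Suc i) \<omega> - X i \<omega> = mark_step \<sigma> (ms ! i)}"
  proof (rule finite_measure_eq_AE)
    show "AE \<omega> in M. (\<omega> \<in> W) = (\<omega> \<in> {\<omega> \<in> space M. \<forall>i<n. X (Suc i) \<omega> - X i \<omega> = mark_step \<sigma> (ms ! i)})"
      using AE_pm_steps AE_space by eventually_elim (auto simp: W_def X_def pm_steps_def)
    show "{\<omega> \<in> space M. \<forall>i<n. X (Suc i) \<omega> - X i \<omega> = mark_step \<sigma> (ms ! i)} \<in> events"
      unfolding X_def by measurable
  qed (rule W_sets)
  also have "\<dots> = (1 / 2) ^ n"
  proof (rule prob_steps[OF walk])
    show "mark_step \<sigma> (ms ! i) = 1 \<or> mark_step \<sigma> (ms ! i) = - 1" for i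
      using \<sigma> by (cases "ms ! i") auto
  qed
  also have "(1 / 2) ^ n * c = (\<Prod>i<n. pmf mark_pmf (ms ! i))"
  proof -
    have "c = (\<Prod>i<n. if ms ! i = None then 1 else pmf rho0 (the (ms ! i)))"
      unfolding c_def I_def by (subst prod.If_cases) (auto intro!: prod.cong)
    then have "(1 / 2) ^ n * c = (\<Prod>i<n. 1 / 2 * (if ms ! i = None then 1 else pmf rho0 (the (ms ! i))))"
      by (subst prod.distrib) simp
    also have "\<dots> = (\<Prod>i<n. pmf mark_pmf (ms ! i))"
      by (intro prod.cong) (auto simp: pmf_mark split: option.splits)
    finally show ?thesis .
  qed
  also have "prob (W \<inter> E) = prob {\<omega> \<in> space M. \<forall>i<n. mark_at \<sigma> (b \<omega>) (T \<omega>) i = ms ! i}"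
  proof (rule finite_measure_eq_AE)
    show "AE \<omega> in M. (\<omega> \<in> W \<inter> E) = (\<omega> \<in> {\<omega> \<in> space M. \<forall>i<n. mark_at \<sigma> (b \<omega>) (T \<omega>) i = ms ! i})"
      using AE_pm_steps AE_space by eventually_elim (auto simp: marks_iff)
    have [measurable]: "(\<lambda>\<omega>. mark_at \<sigma> (b \<omega>) (T \<omega>) i) \<in> measurable M (count_space UNIV)" for i
      by (rule measurable_mark_at)
    show "{\<omega> \<in> space M. \<forall>i<n. mark_at \<sigma> (b \<omega>) (T \<omega>) i = ms ! i} \<in> events"
      by measurable
  qed (use W_sets E_sets in auto)
  finally show ?thesis .
qed

lemma distr_marks:
  assumes "\<sigma> = 1 \<or> \<sigma> = - 1"
  shows "distr M (count_space UNIV) (\<lambda>\<omega>. map (mark_at \<sigma> (b \<omega>) (T \<omega>)) [0..<n]) = measure_pmf (replicate_pmf n mark_pmf)"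
proof (rule measure_eqI_countable[where A = UNIV])
  have meas: "(\<lambda>\<omega>. map (mark_at \<sigma> (b \<omega>) (T \<omega>)) [0..<n]) \<in> measurable M (count_space UNIV)"
    by (rule measurable_map_upt) (rule measurable_mark_at)
  fix ms :: "mark list"
  have eq: "map (mark_at \<sigma> (b \<omega>) (T \<omega>)) [0..<n] = ms \<longleftrightarrow>
      length ms = n \<and> (\<forall>i<n. mark_at \<sigma> (b \<omega>) (T \<omega>) i = ms ! i)" for \<omega>
    unfolding list_eq_iff_nth_eq by (rule iffI; simp)
  have "emeasure (distr M (count_space UNIV) (\<lambda>\<omega>. map (mark_at \<sigma> (b \<omega>) (T \<omega>)) [0..<n])) {ms} =
      prob {\<omega> \<in> space M. length ms = n \<and> (\<forall>i<n. mark_at \<sigma> (b \<omega>) (T \<omega>) i = ms ! i)}"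
    unfolding eq[symmetric] emeasure_eq_measure[symmetric]
    by (subst emeasure_distr[OF meas]) (auto intro!: arg_cong[where f = "emeasure M"])
  also have "\<dots> = pmf (replicate_pmf n mark_pmf) ms"
    using prob_marks[OF assms, of ms n] by (simp add: pmf_replicate_pmf)
  finally show "emeasure (distr M (count_space UNIV) (\<lambda>\<omega>. map (mark_at \<sigma> (b \<omega>) (T \<omega>)) [0..<n])) {ms} =
      emeasure (measure_pmf (replicate_pmf n mark_pmf)) {ms}"
    by (simp add: emeasure_pmf_single)
qed auto

lemma renewal_marks:
  assumes "\<sigma> = 1 \<or> \<sigma> = - 1" "renewal_pred R"
    and "\<And>B :: real. \<exists>N. B < (\<Sum>n<N. measure (replicate_pmf n mark_pmf) {xs. R xs})"
  shows "AE \<omega> in M. \<exists>\<^sub>\<infinity>n. R (map (mark_at \<sigma> (b \<omega>) (T \<omega>)) [0..<n])"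
  by (rule renewal_infinitely_often[OF measurable_mark_at distr_marks[OF assms(1)] assms(2,3)])

text \<open>Every tree at a down-step occurs in a mark of one of the two sides, and almost surely
  all marks lie in the support of their law.\<close>

lemma AE_good_trees: "AE \<omega> in M. good_trees (b \<omega>) (T \<omega>)"
proof -
  have marks: "AE \<omega> in M. \<forall>n. mark_at \<sigma> (b \<omega>) (T \<omega>) n \<in> set_pmf mark_pmf" if \<sigma>: "\<sigma> = 1 \<or> \<sigma> = - 1" for \<sigma>
  proof (subst AE_all_countable, rule allI)
    fix n
    have meas: "(\<lambda>\<omega>. map (mark_at \<sigma> (b \<omega>) (T \<omega>)) [0..<Suc n]) \<in> measurable M (count_space UNIV)"
      by (rule measurable_map_upt) (rule measurable_mark_at)
    have "AE xs in distr M (count_space UNIV) (\<lambda>\<omega>. map (mark_at \<sigma> (b \<omega>) (T \<omega>)) [0..<Suc n]). set xs \<subseteq> set_pmf mark_pmf"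
      unfolding distr_marks[OF \<sigma>] by (rule AE_pmfI) (auto simp: set_replicate_pmf simp del: replicate_pmf.simps)
    then have "AE \<omega> in M. set (map (mark_at \<sigma> (b \<omega>) (T \<omega>)) [0..<Suc n]) \<subseteq> set_pmf mark_pmf"
      by (subst (asm) AE_distr_iff[OF meas]) auto
    then show "AE \<omega> in M. mark_at \<sigma> (b \<omega>) (T \<omega>) n \<in> set_pmf mark_pmf"
      by eventually_elim auto
  qed
  have "AE \<omega> in M. \<forall>n. mark_at 1 (b \<omega>) (T \<omega>) n \<in> set_pmf mark_pmf"
    "AE \<omega> in M. \<forall>n. mark_at (- 1) (b \<omega>) (T \<omega>) n \<in> set_pmf mark_pmf"
    by (rule marks, simp)+
  then show ?thesis
  proof eventually_elim
    case (elim \<omega>)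
    show ?case
      unfolding good_trees_def
    proof
      fix i assume i: "i \<in> DS (b \<omega>)"
      obtain \<sigma> n where n: "i = mark_index \<sigma> n" "mark_at \<sigma> (b \<omega>) (T \<omega>) n \<in> set_pmf mark_pmf"
      proof (cases "i \<ge> 0")
        case True
        then show ?thesis using elim that[of "- 1" "nat i"] by (simp add: mark_index_def)
      next
        case False
        then show ?thesis using elim that[of 1 "nat (- i - 1)"] by (simp add: mark_index_def)
      qed
      then have "Some (shift_labels (- b \<omega> i) (T \<omega> i)) \<in> set_pmf mark_pmf"
        using i by (simp add: mark_at_def Let_def)
      then have "pmf rho0 (shift_labels (- b \<omega> i) (T \<omega> i)) \<noteq> 0"
        by (simp add: set_pmf_iff pmf_mark)
      then show "well_labeled (T \<omega> i) \<and> root_label (T \<omega> i) = b \<omega> i"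
        by (auto simp: pmf_rho0 split: if_splits)
    qed
  qed
qed

end

section \<open>Bottlenecks from cuts\<close>

definition right_bottlenecks :: "(int \<Rightarrow> int) \<Rightarrow> (int \<Rightarrow> ltree) \<Rightarrow> bool" where
  "right_bottlenecks b T \<longleftrightarrow>
     (\<forall>N. \<exists>j\<in>DS b. N \<le> j \<and> 0 \<le> j \<and> (\<forall>i\<in>DS b. 0 \<le> i \<and> i < j \<longrightarrow> labels_in {b j<..} (T i)))"

text \<open>The bound on the labels is weak here but strict on the right. On the left it only has to
  exclude labels below \<open>b j\<close>; on the right the root at \<open>j\<close> must be the
  first corner with its label.\<close>

definition left_bottlenecks :: "(int \<Rightarrow> int) \<Rightarrow> (int \<Rightarrow> ltree) \<Rightarrow> bool" where
  "left_bottlenecks b T \<longleftrightarrow>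
     (\<forall>N. \<exists>j\<in>DS b. j \<le> N \<and> j < 0 \<and> (\<forall>i\<in>DS b. j < i \<and> i < 0 \<longrightarrow> labels_in {b j..} (T i)))"

lemma cut_mark_at:
  assumes \<sigma>: "\<sigma> = 1 \<or> \<sigma> = - 1" and b: "pm_steps b"
    and cut: "cut \<sigma> (map (mark_at \<sigma> b T) [0..<n])"
    and m: "m < n" "mark_index \<sigma> m \<in> DS b"
  shows "labels_in {b (- \<sigma> * int n)<..} (T (mark_index \<sigma> m))"
proof -
  let ?xs = "map (mark_at \<sigma> b T) [0..<n]" and ?i = "mark_index \<sigma> m"
  have "take m ?xs = map (mark_at \<sigma> b T) [0..<m]"
    using m by (simp add: take_map)
  then have disp: "disp \<sigma> (take m ?xs) = b (- \<sigma> * int m)" "disp \<sigma> ?xs = b (- \<sigma> * int n)"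
    using disp_mark_at[OF \<sigma> b] by auto
  have "?xs ! m = Some (shift_labels (- b ?i) (T ?i))"
    using m by (simp add: mark_at_def Let_def)
  with stays_above_nth[OF cut[unfolded cut_def], of m] m(1)
  have "labels_in {- max (- disp \<sigma> ?xs + disp \<sigma> (take m ?xs)) (- disp \<sigma> ?xs + disp \<sigma> (take m ?xs) + \<sigma>)<..}
      (shift_labels (- b ?i) (T ?i))" by simp
  also have "max (- disp \<sigma> ?xs + disp \<sigma> (take m ?xs)) (- disp \<sigma> ?xs + disp \<sigma> (take m ?xs) + \<sigma>) = b ?i - b (- \<sigma> * int n)"
    unfolding disp b_mark_index[OF \<sigma> m(2)] by (simp add: max_def)
  finally have "labels_in ((\<lambda>x. x + - b ?i) -` {- (b ?i - b (- \<sigma> * int n))<..}) (T ?i)"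
    by (simp only: labels_in_shift)
  moreover have "(\<lambda>x. x + - b ?i) -` {- (b ?i - b (- \<sigma> * int n))<..} = {b (- \<sigma> * int n)<..}"
    by auto
  ultimately show ?thesis by simp
qed

lemma right_bottlenecks_if_cuts:
  assumes b: "pm_steps b"
    and cuts: "\<exists>\<^sub>\<infinity>n. ends_in_tree (cut (- 1)) A (map (mark_at (- 1) b T) [0..<n])"
  shows "right_bottlenecks b T"
  unfolding right_bottlenecks_def
proof
  fix N :: int
  obtain n where n: "n \<ge> Suc (nat N)" "ends_in_tree (cut (- 1)) A (map (mark_at (- 1) b T) [0..<n])"
    using cuts by (auto simp: INFM_nat_le)
  \<comment> \<open>Among the \<open>Suc m\<close> marks the last one carries the tree at the
    bottleneck \<open>m\<close>, and the cut consists of the \<open>m\<close> marks before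
    it.\<close>
  then obtain m where m: "n = Suc m" by (cases n) auto
  then have cut: "cut (- 1) (map (mark_at (- 1) b T) [0..<m])" and "mark_at (- 1) b T m \<noteq> None"
    using n by (auto simp: ends_in_tree_def)
  then have "int m \<in> DS b" by (auto simp: mark_at_def mark_index_def Let_def split: if_splits)
  moreover have "labels_in {b (int m)<..} (T i)" if "i \<in> DS b" "0 \<le> i" "i < int m" for i
    using cut_mark_at[of "- 1" b T m "nat i"] b cut that by (simp add: mark_index_def)
  ultimately show "\<exists>j\<in>DS b. N \<le> j \<and> 0 \<le> j \<and> (\<forall>i\<in>DS b. 0 \<le> i \<and> i < j \<longrightarrow> labels_in {b j<..} (T i))"
    using n m by (intro bexI[of _ "int m"]) auto
qed

text \<open>The index \<open>- n\<close> of a cut need not be a down-step; the bottleneck is the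
  first down-step \<open>i0\<close> to the left of it. Going left, the walk falls until it rises
  once at \<open>i0\<close>, so \<open>b i0 \<le> b (- n) + 1\<close>, and the strict bound by
  \<open>b (- n)\<close> becomes the weak bound by \<open>b i0\<close>.\<close>

lemma left_bottlenecks_if_cuts:
  assumes b: "pm_steps b"
    and cuts: "\<exists>\<^sub>\<infinity>n. cut 1 (map (mark_at 1 b T) [0..<n])"
    and trees: "\<exists>\<^sub>\<infinity>n. ends_in_tree R A (map (mark_at 1 b T) [0..<n])"
  shows "left_bottlenecks b T"
  unfolding left_bottlenecks_def
proof
  fix N :: int
  obtain n where n: "n \<ge> nat (- N)" and cut: "cut 1 (map (mark_at 1 b T) [0..<n])"
    using cuts by (auto simp: INFM_nat_le)
  have "\<exists>k. - int n - 1 - int k \<in> DS b"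
  proof -
    obtain m where m: "m \<ge> Suc n" "ends_in_tree R A (map (mark_at 1 b T) [0..<m])"
      using trees by (auto simp: INFM_nat_le)
    then obtain m' where m': "m = Suc m'" by (cases m) auto
    then have "mark_at 1 b T m' \<noteq> None"
      using m by (auto simp: ends_in_tree_def)
    then have "- int m' - 1 \<in> DS b"
      by (auto simp: mark_at_def mark_index_def Let_def split: if_splits)
    moreover have "- int n - 1 - int (m' - n) = - int m' - 1" using m m' by simp
    ultimately show ?thesis by metis
  qed
  then obtain k where k: "- int n - 1 - int k \<in> DS b" and least: "\<And>j. j < k \<Longrightarrow> - int n - 1 - int j \<notin> DS b"
    using exists_least_iff[of "\<lambda>k. - int n - 1 - int k \<in> DS b"] by blast
  have down: "j \<le> k \<Longrightarrow> b (- int n - int j) = b (- int n) - int j" for j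
  proof (induction j)
    case (Suc j)
    have "\<bar>b (- int n - 1 - int j + 1) - b (- int n - 1 - int j)\<bar> = 1"
      using b unfolding pm_steps_def by blast
    moreover have "b (- int n - 1 - int j + 1) \<noteq> b (- int n - 1 - int j) - 1"
      using least[of j] Suc.prems by (auto simp: DS_def)
    ultimately have "b (- int n - 1 - int j) = b (- int n - 1 - int j + 1) - 1" by linarith
    moreover have "- int n - 1 - int j + 1 = - int n - int j" "- int n - 1 - int j = - int n - int (Suc j)" by auto
    ultimately show ?case using Suc by simp
  qed simp
  define i0 where "i0 = - int n - 1 - int k"
  have "b i0 = b (i0 + 1) + 1" using k by (simp add: DS_def i0_def)
  also have "i0 + 1 = - int n - int k" by (simp add: i0_def)
  finally have bi0: "b i0 \<le> b (- int n) + 1" using down[of k] by simp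
  have "labels_in {b i0..} (T i)" if i: "i \<in> DS b" "i0 < i" "i < 0" for i
  proof -
    have "i \<ge> - int n"
    proof (rule ccontr)
      assume "\<not> i \<ge> - int n"
      then have "- int n - 1 - int (nat (- int n - 1 - i)) = i" "nat (- int n - 1 - i) < k"
        using i by (auto simp: i0_def)
      then show False using least i(1) by metis
    qed
    then have "labels_in {b (- int n)<..} (T i)"
      using cut_mark_at[of 1 b T n "nat (- i - 1)"] b cut i by (simp add: mark_index_def)
    then show ?thesis by (rule labels_in_mono) (use bi0 in auto)
  qed
  then show "\<exists>j\<in>DS b. j \<le> N \<and> j < 0 \<and> (\<forall>i\<in>DS b. j < i \<and> i < 0 \<longrightarrow> labels_in {b j..} (T i))"
    using k n by (intro bexI[of _ i0]) (auto simp: i0_def)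
qed

context uniform_infinite_treed_bridge
begin

lemma AE_right_bottlenecks: "AE \<omega> in M. right_bottlenecks (b \<omega>) (T \<omega>)"
proof -
  \<comment> \<open>These are the trees that stay above the lower end of their own step, which is
    what \<open>cut\<close> asks of a single mark with a tree.\<close>
  let ?A = "{t. labels_in {- 1<..} t}"
  have "measure rho0 ?A > 0"
    using prob_rho0_above[of 1] pos_frac_pos[of 1] by simp
  then have "AE \<omega> in M. \<exists>\<^sub>\<infinity>n. ends_in_tree (cut (- 1)) ?A (map (mark_at (- 1) (b \<omega>) (T \<omega>)) [0..<n])"
    by (intro renewal_marks renewal_ends_in_tree renewal_cut ends_in_tree_diverges cut_diverges)
       (auto simp: cut_def)
  with AE_pm_steps show ?thesis
    by eventually_elim (rule right_bottlenecks_if_cuts)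
qed

lemma AE_left_bottlenecks: "AE \<omega> in M. left_bottlenecks (b \<omega>) (T \<omega>)"
proof -
  have "AE \<omega> in M. \<exists>\<^sub>\<infinity>n. cut 1 (map (mark_at 1 (b \<omega>) (T \<omega>)) [0..<n])"
    by (intro renewal_marks renewal_cut cut_diverges) auto
  \<comment> \<open>With the trivial \<open>R\<close>, the renewal argument says that the down-steps
    are unbounded to the left.\<close>
  moreover have "AE \<omega> in M. \<exists>\<^sub>\<infinity>n. ends_in_tree (\<lambda>_. True) UNIV (map (mark_at 1 (b \<omega>) (T \<omega>)) [0..<n])"
  proof (intro renewal_marks renewal_ends_in_tree ends_in_tree_diverges)
    fix B :: real
    obtain N :: nat where "B < real N" using reals_Archimedean2 by blast
    then show "\<exists>N. B < (\<Sum>n<N. measure (replicate_pmf n mark_pmf) {xs. True})"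
      by (intro exI[of _ N]) simp
  qed (auto simp: renewal_pred_def)
  ultimately show ?thesis
    using AE_pm_steps by eventually_elim (rule left_bottlenecks_if_cuts)
qed

end

section \<open>Contours and enumerations\<close>

lemma contour_ne [simp]: "contour t \<noteq> []"
  by (cases t) simp

lemma contour_0 [simp]: "contour t ! 0 = []" and hd_contour [simp]: "hd (contour t) = []"
  by (cases t; simp)+

lemma contour_forest_Nil_iff [simp]: "contour_forest j ts = [] \<longleftrightarrow> ts = []"
  by (cases ts) auto

lemma last_contour_forest: "ts \<noteq> [] \<Longrightarrow> last (contour_forest j ts) = []"
  by (induction ts arbitrary: j) auto

lemma last_contour [simp]: "last (contour t) = []"
  by (cases t) (auto simp: last_contour_forest)

lemma set_contour: "set (contour t) = {p. is_vertex t p}"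
  and set_contour_forest: "set (contour_forest j ts) =
    {p. p = [] \<and> ts \<noteq> [] \<or> (\<exists>i<length ts. \<exists>q. p = (j + i) # q \<and> is_vertex (ts ! i) q)}"
proof (induction t and j ts rule: contour_contour_forest.induct)
  case (1 l ts)
  have "is_vertex (Node l ts) p \<longleftrightarrow> p = [] \<or> (\<exists>i<length ts. \<exists>q. p = i # q \<and> is_vertex (ts ! i) q)" for p
    by (cases p) auto
  then show ?case using 1 by auto
next
  case (3 j t ts)
  have "(\<exists>i<length (t # ts). \<exists>q. p = (j + i) # q \<and> is_vertex ((t # ts) ! i) q) \<longleftrightarrow>
     (\<exists>q. p = j # q \<and> is_vertex t q) \<or> (\<exists>i<length ts. \<exists>q. p = (Suc j + i) # q \<and> is_vertex (ts ! i) q)" for p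
    by (simp add: Ex_less_Suc2)
  then show ?case using 3 by auto
qed simp

text \<open>Consecutive corners are joined by a tree edge. In the forest version \<open>s\<close> is
  the parent, \<open>ts\<close> are its children from index \<open>j\<close> on, and the leading
  \<open>[]\<close> is the visit of the parent before them.\<close>

lemma contour_labels_adjacent:
  "well_labeled t \<Longrightarrow> successively (\<lambda>p q. \<bar>label_at t p - label_at t q\<bar> \<le> 1) (contour t)"
  and "well_labeled s \<Longrightarrow> drop j (children s) = ts \<Longrightarrow>
    successively (\<lambda>p q. \<bar>label_at s p - label_at s q\<bar> \<le> 1) ([] # contour_forest j ts)"
proof (induction t and j ts arbitrary: and s rule: contour_contour_forest.induct)
  case (1 l ts)
  then show ?case by simp
next
  case (3 j t ts)
  have t: "t = children s ! j" "j < length (children s)" "drop (Suc j) (children s) = ts"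
    using 3(4) by (auto simp: drop_Suc tl_drop nth_via_drop dest: arg_cong[where f = tl])
      (metis drop_eq_Nil2 list.discI not_le)
  then have "well_labeled t" "\<bar>root_label t - root_label s\<bar> \<le> 1"
    using 3(3) nth_mem by (cases s; fastforce)+
  then show ?case
    using 3(1)[OF \<open>well_labeled t\<close>] 3(2)[OF 3(3) t(3)] t(1)
    by (auto simp: successively_append_iff successively_map successively_Cons hd_map last_map abs_minus_commute)
qed simp

lemma label_at_in: "labels_in S t \<Longrightarrow> is_vertex t p \<Longrightarrow> label_at t p \<in> S"
proof (induction p arbitrary: t)
  case Nil
  then show ?case by (cases t) simp
next
  case (Cons j p)
  then show ?case by (cases t) auto
qed

text \<open>A locally finite linear order without maximum has immediate successors, and an element
  above \<open>a\<close> missed by iterating them would have infinitely many elements below it and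
  above \<open>a\<close>. The relation is a parameter because the converse order is enumerated in
  the same way.\<close>

lemma ex_ray_enumeration:
  fixes R :: "'a \<Rightarrow> 'a \<Rightarrow> bool"
  assumes total: "\<And>x y. x \<in> C \<Longrightarrow> y \<in> C \<Longrightarrow> x = y \<or> R x y \<or> R y x"
    and irrefl: "\<And>x. \<not> R x x" and trans: "\<And>x y z. R x y \<Longrightarrow> R y z \<Longrightarrow> R x z"
    and fin: "\<And>x y. x \<in> C \<Longrightarrow> y \<in> C \<Longrightarrow> finite {z \<in> C. R x z \<and> R z y}"
    and unbdd: "\<And>x. x \<in> C \<Longrightarrow> \<exists>y\<in>C. R x y" and a: "a \<in> C"
  shows "\<exists>f :: nat \<Rightarrow> 'a. f 0 = a \<and> (\<forall>n. f n \<in> C \<and> R (f n) (f (Suc n))) \<and>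
    (\<forall>x\<in>C. R a x \<longrightarrow> (\<exists>n. x = f n))"
proof -
  have "\<exists>y. y \<in> C \<and> R x y \<and> \<not> (\<exists>z\<in>C. R x z \<and> R z y)" if x: "x \<in> C" for x
  proof -
    obtain y0 where y0: "y0 \<in> C" "R x y0" using unbdd x by blast
    let ?S = "\<lambda>y. {z \<in> C. R x z \<and> R z y}"
    \<comment> \<open>An element above \<open>x\<close> with the fewest elements in between is the
      immediate successor of \<open>x\<close>.\<close>
    obtain y where y: "y \<in> C" "R x y" and min: "\<And>z. z \<in> C \<Longrightarrow> R x z \<Longrightarrow> card (?S y) \<le> card (?S z)"
      using ex_has_least_nat[of "\<lambda>y. y \<in> C \<and> R x y" y0 "\<lambda>y. card (?S y)"] y0 by blast
    have "\<not> (\<exists>z\<in>C. R x z \<and> R z y)"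
    proof
      assume "\<exists>z\<in>C. R x z \<and> R z y"
      then obtain z where z: "z \<in> C" "R x z" "R z y" by blast
      then have "?S z \<subset> ?S y" using trans irrefl by blast
      then have "card (?S z) < card (?S y)" using fin[OF x y(1)] by (rule psubset_card_mono[rotated])
      then show False using min[OF z(1,2)] by simp
    qed
    then show ?thesis using y by blast
  qed
  then obtain nx where nx: "\<And>x. x \<in> C \<Longrightarrow> nx x \<in> C \<and> R x (nx x) \<and> \<not> (\<exists>z\<in>C. R x z \<and> R z (nx x))"
    by metis
  define f where "f n = (nx ^^ n) a" for n
  have f_0: "f 0 = a" by (simp add: f_def)
  have f: "f n \<in> C" for n by (induction n) (auto simp: f_def a nx)
  have less_f: "R (f n) (f (Suc n))" for n using nx[OF f[of n]] by (simp add: f_def)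
  have less_f': "R (f m) (f n)" if "m < n" for m n
    using that by (induction rule: less_Suc_induct) (auto intro: less_f trans)
  have "\<exists>n. x = f n" if x: "x \<in> C" "R a x" for x
  proof (rule ccontr)
    assume notin: "\<nexists>n. x = f n"
    have lt: "R (f n) x" for n
    proof (induction n)
      case 0
      then show ?case using x by (simp add: f_def)
    next
      case (Suc n)
      then have "\<not> R x (f (Suc n))" using nx[OF f[of n]] x by (auto simp: f_def)
      then show ?case using total[OF x(1) f[of "Suc n"]] notin by metis
    qed
    have "inj (\<lambda>n. f (Suc n))"
      by (rule linorder_injI) (metis less_f' irrefl Suc_mono)
    moreover have "range (\<lambda>n. f (Suc n)) \<subseteq> {z \<in> C. R a z \<and> R z x}"
      using f lt less_f'[of 0] f_0 by auto
    ultimately show False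
      using fin[OF a x(1)] finite_subset finite_imageD infinite_UNIV_nat by metis
  qed
  then show ?thesis using f_0 f less_f by blast
qed

lemma ex_int_enumeration:
  fixes R :: "'a \<Rightarrow> 'a \<Rightarrow> bool"
  assumes total: "\<And>x y. x \<in> C \<Longrightarrow> y \<in> C \<Longrightarrow> x = y \<or> R x y \<or> R y x"
    and irrefl: "\<And>x. \<not> R x x" and trans: "\<And>x y z. R x y \<Longrightarrow> R y z \<Longrightarrow> R x z"
    and fin: "\<And>x y. x \<in> C \<Longrightarrow> y \<in> C \<Longrightarrow> finite {z \<in> C. R x z \<and> R z y}"
    and above: "\<And>x. x \<in> C \<Longrightarrow> \<exists>y\<in>C. R x y" and below: "\<And>x. x \<in> C \<Longrightarrow> \<exists>y\<in>C. R y x"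
    and a: "a \<in> C"
  shows "\<exists>c :: int \<Rightarrow> 'a. c 0 = a \<and> bij_betw c UNIV C \<and> (\<forall>m n. m < n \<longrightarrow> R (c m) (c n))"
proof -
  have "\<exists>f :: nat \<Rightarrow> 'a. f 0 = a \<and> (\<forall>n. f n \<in> C \<and> R (f n) (f (Suc n))) \<and>
      (\<forall>x\<in>C. R a x \<longrightarrow> (\<exists>n. x = f n))"
    by (rule ex_ray_enumeration; fact)
  then obtain f :: "nat \<Rightarrow> 'a" where f: "f 0 = a" "\<And>n. f n \<in> C" "\<And>n. R (f n) (f (Suc n))"
    "\<And>x. x \<in> C \<Longrightarrow> R a x \<Longrightarrow> \<exists>n. x = f n"
    by blast
  have fin': "finite {z \<in> C. R z x \<and> R y z}" if "x \<in> C" "y \<in> C" for x y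
    using fin[OF that(2,1)] by (simp add: conj_commute)
  have total': "x = y \<or> R y x \<or> R x y" if "x \<in> C" "y \<in> C" for x y
    using total[OF that] by blast
  have trans': "R z x" if "R y x" "R z y" for x y z using trans that by blast
  have "\<exists>g :: nat \<Rightarrow> 'a. g 0 = a \<and> (\<forall>n. g n \<in> C \<and> R (g (Suc n)) (g n)) \<and>
      (\<forall>x\<in>C. R x a \<longrightarrow> (\<exists>n. x = g n))"
    by (rule ex_ray_enumeration[where R = "\<lambda>x y. R y x"]; fact)
  then obtain g :: "nat \<Rightarrow> 'a" where g: "g 0 = a" "\<And>n. g n \<in> C" "\<And>n. R (g (Suc n)) (g n)"
    "\<And>x. x \<in> C \<Longrightarrow> R x a \<Longrightarrow> \<exists>n. x = g n"
    by blast
  define c where "c n = (if n \<ge> 0 then f (nat n) else g (nat (- n)))" for n :: int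
  have step: "R (c n) (c (n + 1))" for n
  proof (cases "n \<ge> 0")
    case True
    then show ?thesis using f(3)[of "nat n"] by (simp add: c_def nat_add_distrib)
  next
    case False
    then have "nat (- n) = Suc (nat (- (n + 1)))" by simp
    then show ?thesis using g(3)[of "nat (- (n + 1))"] False f(1) g(1)
      by (cases "n = - 1") (auto simp: c_def)
  qed
  have mono: "R (c m) (c n)" if "m < n" for m n
    using that
  proof (induction n rule: int_gr_induct)
    case base
    show ?case by (rule step)
  next
    case (step i)
    then show ?case using \<open>\<And>n. R (c n) (c (n + 1))\<close> trans by blast
  qed
  have "x \<in> range c" if x: "x \<in> C" for x
  proof -
    consider "x = a" | "R a x" | "R x a" using total[OF x a] by blast
    then show ?thesis
    proof cases
      case 1
      then show ?thesis using f(1) by (auto simp: c_def intro!: image_eqI[of _ _ 0])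
    next
      case 2
      then obtain n where "x = f n" using f(4) x by blast
      then show ?thesis by (auto simp: c_def intro!: image_eqI[of _ _ "int n"])
    next
      case 3
      then obtain n where n: "x = g n" using g(4) x by blast
      then have "n \<noteq> 0" using 3 g(1) irrefl by metis
      then show ?thesis using n by (auto simp: c_def intro!: image_eqI[of _ _ "- int n"])
    qed
  qed
  moreover have "c n \<in> C" for n using f(2) g(2) by (simp add: c_def)
  moreover have "inj c" by (rule linorder_injI) (metis mono irrefl)
  ultimately have "bij_betw c UNIV C" by (auto simp: bij_betw_def)
  moreover have "c 0 = a" using f(1) by (simp add: c_def)
  ultimately show ?thesis using mono by blast
qed

text \<open>The map between two enumerations is an order automorphism of the integers, hence a
  shift, and the common value at 0 makes it the identity. This uniqueness gives the definite
  description in \<open>corner_seq\<close> a meaning.\<close>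

lemma int_enumeration_unique:
  fixes R :: "'a \<Rightarrow> 'a \<Rightarrow> bool" and c c' :: "int \<Rightarrow> 'a"
  assumes irrefl: "\<And>x. \<not> R x x" and trans: "\<And>x y z. R x y \<Longrightarrow> R y z \<Longrightarrow> R x z"
    and c: "bij_betw c UNIV C" "\<And>m n. m < n \<Longrightarrow> R (c m) (c n)"
    and c': "bij_betw c' UNIV C" "\<And>m n. m < n \<Longrightarrow> R (c' m) (c' n)"
    and eq: "c 0 = c' 0"
  shows "c = c'"
proof -
  have less_iff: "R (c m) (c n) \<longleftrightarrow> m < n" "R (c' m) (c' n) \<longleftrightarrow> m < n" for m n
    using c(2) c'(2) irrefl trans by (metis linorder_neqE)+
  define g where "g n = inv c' (c n)" for n
  have cg: "c' (g n) = c n" for n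
  proof -
    have "c n \<in> range c'" using c(1) c'(1) by (auto simp: bij_betw_def)
    then show ?thesis by (simp add: g_def f_inv_into_f)
  qed
  have mono: "g m < g n \<longleftrightarrow> m < n" for m n
    using less_iff(1)[of m n] less_iff(2)[of "g m" "g n"] by (simp add: cg)
  have surj: "\<exists>m. g m = n" for n
  proof -
    have "c' n \<in> range c" using c(1) c'(1) by (auto simp: bij_betw_def)
    then obtain m where "c m = c' n" by auto
    then have "c' (g m) = c' n" by (simp add: cg)
    then show ?thesis using c'(1) by (auto simp: bij_betw_def dest: injD)
  qed
  have step: "g (n + 1) = g n + 1" for n
  proof -
    obtain m where m: "g m = g n + 1" using surj by blast
    then have "n < m" using mono[of n m] by simp
    then have "\<not> g m < g (n + 1)" using mono[of m "n + 1"] by simp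
    moreover have "g n < g (n + 1)" using mono[of n "n + 1"] by simp
    ultimately show ?thesis using m by simp
  qed
  have "c' (g 0) = c' 0" using cg[of 0] eq by simp
  then have g0: "g 0 = 0" using c'(1) by (auto simp: bij_betw_def dest: injD)
  have "g n = n" for n
  proof (induction n rule: int_induct[where k = 0])
    case (step2 i)
    then show ?case using step[of "i - 1"] by simp
  qed (auto simp: g0 step)
  then show ?thesis using cg by (metis ext)
qed

section \<open>Geodesic rays\<close>

lemma corner_less_trans: "corner_less c d \<Longrightarrow> corner_less d e \<Longrightarrow> corner_less c e"
  by (auto simp: corner_less_def)

lemma corner_less_irrefl: "\<not> corner_less c c"
  by (simp add: corner_less_def)

lemma corner_less_total: "c = d \<or> corner_less c d \<or> corner_less d c"
  by (auto simp: corner_less_def prod_eq_iff)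

lemma root_label_in: "labels_in S t \<Longrightarrow> root_label t \<in> S"
  by (cases t) simp

section \<open>Deterministic consequences of the almost sure properties\<close>

locale bottlenecked_bridge =
  fixes b :: "int \<Rightarrow> int" and T :: "int \<Rightarrow> ltree"
  assumes pm: "pm_steps b" and good: "good_trees b T"
    and right: "right_bottlenecks b T" and left: "left_bottlenecks b T"
begin

abbreviation C :: "corner set" where "C \<equiv> real_corners b T"

lemma root_label_eq: "i \<in> DS b \<Longrightarrow> root_label (T i) = b i"
  using good by (simp add: good_trees_def)

text \<open>A bottleneck has a smaller label than the root of any earlier one, so going from one to
  the next pushes the label below any given level. This is the source of the unboundedness of labels
  from below.\<close>

lemma right_bottleneck_low: "\<exists>j\<in>DS b. N \<le> j \<and> 0 \<le> j \<and> b j \<le> K \<and>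
    (\<forall>i\<in>DS b. 0 \<le> i \<and> i < j \<longrightarrow> labels_in {b j<..} (T i))"
proof -
  let ?P = "\<lambda>K N j. j \<in> DS b \<and> N \<le> j \<and> 0 \<le> j \<and> b j \<le> K \<and>
      (\<forall>i\<in>DS b. 0 \<le> i \<and> i < j \<longrightarrow> labels_in {b j<..} (T i))"
  obtain j0 where j0: "?P (b j0) 0 j0" using right unfolding right_bottlenecks_def by blast
  have "\<exists>j. ?P (b j0 - int n) N j" for n N
  proof (induction n arbitrary: N)
    case 0
    obtain j where j: "j \<in> DS b" "max N (j0 + 1) \<le> j" "0 \<le> j" "\<forall>i\<in>DS b. 0 \<le> i \<and> i < j \<longrightarrow> labels_in {b j<..} (T i)"
      using right unfolding right_bottlenecks_def by blast
    then have "b j < b j0" using j0 root_label_in[of "{b j<..}" "T j0"] root_label_eq by auto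
    then show ?case using j by (intro exI[of _ j]) auto
  next
    case (Suc n)
    obtain j1 where j1: "?P (b j0 - int n) N j1" using Suc by blast
    obtain j where j: "j \<in> DS b" "max N (j1 + 1) \<le> j" "0 \<le> j" "\<forall>i\<in>DS b. 0 \<le> i \<and> i < j \<longrightarrow> labels_in {b j<..} (T i)"
      using right unfolding right_bottlenecks_def by blast
    then have "b j < b j1" using j1 root_label_in[of "{b j<..}" "T j1"] root_label_eq by auto
    then show ?case using j j1 by (intro exI[of _ j]) auto
  qed
  then obtain j where "?P (b j0 - int (nat (b j0 - K))) N j" by blast
  moreover have "b j0 - int (nat (b j0 - K)) \<le> K" by linarith
  ultimately show ?thesis by (intro bexI[of _ j]) auto
qed

lemma root_corner: "i \<in> DS b \<Longrightarrow> (i, 0) \<in> C"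
  by (simp add: real_corners_def)

lemma finite_corners_between: "finite {d \<in> C. corner_less c d \<and> corner_less d e}"
proof (rule finite_subset)
  show "{d \<in> C. corner_less c d \<and> corner_less d e} \<subseteq> (SIGMA i:{fst c..fst e}. {..<length (contour (T i))})"
    by (auto simp: real_corners_def corner_less_def)
qed auto

text \<open>The last index with a non-negative value before a bottleneck of negative label is a
  down-step at level 0. A leftmost corner of label 0 then exists because the lexicographic order is
  well-founded on non-negative indices.\<close>

lemma ex_origin_corner: "\<exists>c. is_origin_corner b T c"
proof -
  obtain j where j: "j \<ge> 0" "b j \<le> - 1"
    using right_bottleneck_low by blast
  let ?S = "{k \<in> {0..j}. b k \<ge> 0}"
  define i where "i = Max ?S"
  have fin: "finite ?S" by (rule finite_subset[of _ "{0..j}"]) auto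
  have b0: "b 0 = 0" using pm by (simp add: pm_steps_def)
  have "i \<in> ?S" unfolding i_def using j b0 by (intro Max_in fin) auto
  moreover have "i \<noteq> j" using calculation j by auto
  ultimately have i: "0 \<le> i" "i < j" "b i \<ge> 0" by auto
  have "i + 1 \<notin> ?S"
  proof
    assume "i + 1 \<in> ?S"
    then have "i + 1 \<le> i" unfolding i_def by (intro Max_ge fin)
    then show False by simp
  qed
  then have "b (i + 1) < 0" using i by simp
  moreover have "\<bar>b (i + 1) - b i\<bar> = 1" using pm by (simp add: pm_steps_def)
  ultimately have "b i = 0" "i \<in> DS b" using i by (auto simp: DS_def)
  define Z where "Z = {d \<in> C. 0 \<le> fst d \<and> corner_label T d = 0}"
  have "label_at (T i) [] = 0" using \<open>b i = 0\<close> root_label_eq[OF \<open>i \<in> DS b\<close>] by simp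
  then have inZ: "(i, 0) \<in> Z"
    using i root_corner[OF \<open>i \<in> DS b\<close>]
    by (simp add: Z_def corner_label_def vertex_label_def corner_vertex_def)
  have wf: "wf (inv_image (less_than <*lex*> less_than) (\<lambda>d :: corner. (nat (fst d), snd d)))"
    by (intro wf_inv_image wf_lex_prod wf_less_than)
  obtain z where z: "z \<in> Z"
    "\<forall>y. (y, z) \<in> inv_image (less_than <*lex*> less_than) (\<lambda>d. (nat (fst d), snd d)) \<longrightarrow> y \<notin> Z"
    using wf inZ unfolding wf_eq_minimal by blast
  have "\<not> corner_less d z" if "d \<in> Z" for d
    using that z(1) z(2)[THEN spec, of d] by (auto simp: corner_less_def Z_def)
  then show ?thesis
    using z(1) unfolding is_origin_corner_def Let_def Z_def[symmetric] by blast
qed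

definition c :: "int \<Rightarrow> corner" where "c = corner_seq b T"

lemma corner_seq_spec: "bij_betw c UNIV C \<and> (\<forall>m n. m < n \<longrightarrow> corner_less (c m) (c n))"
proof -
  let ?P = "\<lambda>c :: int \<Rightarrow> corner. bij_betw c UNIV C \<and> (\<forall>m n. m < n \<longrightarrow> corner_less (c m) (c n)) \<and> is_origin_corner b T (c 0)"
  obtain o' where o': "is_origin_corner b T o'" using ex_origin_corner by blast
  then have "o' \<in> C" by (simp add: is_origin_corner_def Let_def)
  have above: "\<exists>d\<in>C. corner_less e d" for e
  proof -
    obtain j where "j \<in> DS b" "fst e + 1 \<le> j" using right_bottleneck_low by blast
    then show ?thesis by (intro bexI[of _ "(j, 0)"] root_corner) (auto simp: corner_less_def)
  qed
  have below: "\<exists>d\<in>C. corner_less d e" for e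
  proof -
    obtain j where "j \<in> DS b" "j \<le> fst e - 1" using left unfolding left_bottlenecks_def by blast
    then show ?thesis by (intro bexI[of _ "(j, 0)"] root_corner) (auto simp: corner_less_def)
  qed
  have "\<exists>c0 :: int \<Rightarrow> corner. c0 0 = o' \<and> bij_betw c0 UNIV C \<and> (\<forall>m n. m < n \<longrightarrow> corner_less (c0 m) (c0 n))"
    by (rule ex_int_enumeration;
        rule corner_less_total corner_less_irrefl corner_less_trans finite_corners_between above below \<open>o' \<in> C\<close>; assumption)
  then obtain c0 where c0: "?P c0" using o' by metis
  moreover have "c1 = c0" if c1: "?P c1" for c1
  proof (rule int_enumeration_unique[where R = corner_less and C = C])
    show "c1 0 = c0 0"
      using c0 c1 corner_less_total[of "c1 0" "c0 0"] unfolding is_origin_corner_def Let_def by blast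
  qed (use c0 c1 corner_less_irrefl corner_less_trans in blast)+
  ultimately have "?P (THE c. ?P c)" by (rule theI)
  then show ?thesis by (simp add: c_def corner_seq_def)
qed

lemma c_less_iff: "corner_less (c m) (c n) \<longleftrightarrow> m < n"
  using corner_seq_spec corner_less_irrefl corner_less_trans by (metis linorder_neqE)

lemma c_in: "c n \<in> C"
  using corner_seq_spec by (auto simp: bij_betw_def)

lemma ex_c: "d \<in> C \<Longrightarrow> \<exists>n. c n = d"
  using corner_seq_spec unfolding bij_betw_def by (metis rangeE)

section \<open>Labels along the corner sequence\<close>

definition I :: "int \<Rightarrow> int" where "I n = fst (c n)"
definition v :: "int \<Rightarrow> vertex" where "v n = corner_vertex T (c n)"
definition L :: "int \<Rightarrow> int" where "L n = corner_label T (c n)"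

abbreviation V :: "vertex set" where "V \<equiv> real_vertices b T"
abbreviation E :: "(vertex \<times> vertex) set" where "E \<equiv> uihpq_adj b T"
abbreviation lab :: "vertex \<Rightarrow> int" where "lab \<equiv> vertex_label T"

lemma L_eq: "L n = lab (v n)"
  by (simp add: L_def v_def corner_label_def)

lemma fst_v: "fst (v n) = I n"
  by (simp add: v_def I_def corner_vertex_def)

lemma I_in_DS: "I n \<in> DS b"
  using c_in[of n] by (auto simp: I_def real_corners_def)

lemma I_mono: "m \<le> n \<Longrightarrow> I m \<le> I n"
  using c_less_iff[of m n] by (cases "m = n") (auto simp: I_def corner_less_def)

lemma is_vertex_corner: "is_vertex (T (I n)) (snd (v n))"
proof -
  have "contour (T (fst (c n))) ! snd (c n) \<in> set (contour (T (fst (c n))))"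
    using c_in[of n] by (auto simp: real_corners_def)
  then show ?thesis by (simp add: set_contour v_def corner_vertex_def I_def)
qed

lemma L_in: "labels_in S (T (I n)) \<Longrightarrow> L n \<in> S"
  using label_at_in[OF _ is_vertex_corner] by (simp add: L_eq vertex_label_def fst_v)

lemma ex_v:
  assumes "u \<in> V" shows "\<exists>n. v n = u"
proof -
  obtain i p where u: "u = (i, p)" "i \<in> DS b" "is_vertex (T i) p"
    using assms by (auto simp: real_vertices_def)
  then obtain k where "k < length (contour (T i))" "contour (T i) ! k = p"
    using set_contour[of "T i"] by (metis in_set_conv_nth mem_Collect_eq)
  then have "(i, k) \<in> C" "corner_vertex T (i, k) = u"
    using u by (auto simp: real_corners_def corner_vertex_def)
  then show ?thesis using ex_c by (metis v_def)
qed

lemma finite_vertices: "finite {u \<in> V. fst u \<in> {i..j}}"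
proof (rule finite_subset)
  show "{u \<in> V. fst u \<in> {i..j}} \<subseteq> (SIGMA k:{i..j}. set (contour (T k)))"
    by (auto simp: real_vertices_def set_contour)
qed auto

text \<open>A contour starts and ends at the root, so a tree occupies an interval of corners with
  label \<open>b i\<close> at both ends.\<close>

lemma first_corner:
  assumes "i \<in> DS b"
  obtains n where "I n = i" "L n = b i" "\<And>m. n \<le> m \<longleftrightarrow> i \<le> I m"
proof -
  obtain n where n: "c n = (i, 0)" using ex_c[OF root_corner[OF assms]] by blast
  have "n \<le> m \<longleftrightarrow> i \<le> I m" for m
    using c_less_iff[of m n] n by (auto simp: corner_less_def I_def)
  moreover have "L n = b i"
    using root_label_eq[OF assms] by (simp add: L_def n corner_label_def corner_vertex_def vertex_label_def)
  ultimately show ?thesis using that[of n] n by (simp add: I_def)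
qed

lemma last_corner:
  assumes "i \<in> DS b"
  obtains n where "I n = i" "L n = b i" "\<And>m. m \<le> n \<longleftrightarrow> I m \<le> i"
proof -
  let ?k = "length (contour (T i)) - 1"
  have "(i, ?k) \<in> C" using assms by (simp add: real_corners_def)
  then obtain n where n: "c n = (i, ?k)" using ex_c by blast
  have "m \<le> n \<longleftrightarrow> I m \<le> i" for m
    using c_less_iff[of n m] n c_in[of m] by (auto simp: corner_less_def I_def real_corners_def)
  moreover have "L n = b i"
    using root_label_eq[OF assms] last_conv_nth[of "contour (T i)"]
    by (simp add: L_def n corner_label_def corner_vertex_def vertex_label_def)
  ultimately show ?thesis using that[of n] n by (simp add: I_def)
qed

text \<open>After the down-step at \<open>i\<close> the walk can only rise until the next
  down-step.\<close>

lemma bridge_between: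
  assumes "i \<in> DS b" "i' \<in> DS b" "i < i'" and none: "\<And>k. i < k \<Longrightarrow> k < i' \<Longrightarrow> k \<notin> DS b"
  shows "b i' \<ge> b i - 1"
proof -
  have "k \<le> i' \<Longrightarrow> b k \<ge> b i - 1" if "i + 1 \<le> k" for k
    using that
  proof (induction k rule: int_ge_induct)
    case base
    then show ?case using assms(1) by (simp add: DS_def)
  next
    case (step k)
    have "\<bar>b (k + 1) - b k\<bar> = 1" using pm by (simp add: pm_steps_def)
    moreover have "b (k + 1) \<noteq> b k - 1" using none[of k] step by (auto simp: DS_def)
    ultimately show ?case using step by simp
  qed
  then show ?thesis using assms(3) by simp
qed

text \<open>Labels may jump up by any amount between two trees, but they fall by at most one, so no
  level is skipped on the way down.\<close>

lemma L_step: "L (n + 1) \<ge> L n - 1"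
proof (cases "I (n + 1) = I n")
  case True
  define i where "i = I n"
  define k k' where "k = snd (c n)" and "k' = snd (c (n + 1))"
  have cn: "c n = (i, k)" "c (n + 1) = (i, k')" using True by (auto simp: i_def k_def k'_def I_def prod_eq_iff)
  have "k < k'" using c_less_iff[of n "n + 1"] by (simp add: cn corner_less_def)
  have k': "k' < length (contour (T i))" "i \<in> DS b" using c_in[of "n + 1"] by (auto simp: cn real_corners_def)
  then have "(i, Suc k) \<in> C" using \<open>k < k'\<close> by (simp add: real_corners_def)
  then obtain m where m: "c m = (i, Suc k)" using ex_c by blast
  then have "n < m" using c_less_iff[of n m] by (simp add: cn corner_less_def)
  then have "k' \<le> Suc k" using c_less_iff[of m "n + 1"] by (simp add: cn m corner_less_def)
  then have "k' = Suc k" using \<open>k < k'\<close> by simp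
  then have "\<bar>label_at (T i) (contour (T i) ! k) - label_at (T i) (contour (T i) ! k')\<bar> \<le> 1"
    using contour_labels_adjacent(1)[of "T i"] good k' by (auto simp: good_trees_def successively_conv_nth)
  then show ?thesis
    by (simp add: L_def cn corner_label_def vertex_label_def corner_vertex_def)
next
  case False
  then have lt: "I n < I (n + 1)" using I_mono[of n "n + 1"] by simp
  obtain q where q: "I q = I n" "L q = b (I n)" "\<And>m. m \<le> q \<longleftrightarrow> I m \<le> I n"
    using last_corner[OF I_in_DS[of n]] by blast
  obtain p where p: "I p = I (n + 1)" "L p = b (I (n + 1))" "\<And>m. p \<le> m \<longleftrightarrow> I (n + 1) \<le> I m"
    using first_corner[OF I_in_DS[of "n + 1"]] by blast
  \<comment> \<open>The corner \<open>n\<close> is the last one of its tree and \<open>n + 1\<close>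
    the first one of the next tree, so only the bridge matters.\<close>
  have "q = n" using q(3)[of n] q(3)[of "n + 1"] lt by simp
  have "p = n + 1" using p(3)[of n] p(3)[of "n + 1"] lt by simp
  have "b (I (n + 1)) \<ge> b (I n) - 1"
  proof (rule bridge_between[OF I_in_DS I_in_DS lt])
    fix k assume k: "I n < k" "k < I (n + 1)"
    show "k \<notin> DS b"
    proof
      assume "k \<in> DS b"
      then obtain m where "I m = k" by (rule first_corner)
      then have "\<not> m \<le> n" "\<not> n + 1 \<le> m" using k I_mono[of m n] I_mono[of "n + 1" m] by auto
      then show False by simp
    qed
  qed
  then show ?thesis using p(2) q(2) \<open>q = n\<close> \<open>p = n + 1\<close> by simp
qed

text \<open>A strict record minimum of the labels read from \<open>n\<close> on. As no level is
  skipped, these records are the corners reached from \<open>n\<close> by iterating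
  successors.\<close>

definition first_hit :: "int \<Rightarrow> int \<Rightarrow> bool" where
  "first_hit n m \<longleftrightarrow> n \<le> m \<and> (\<forall>k. n \<le> k \<and> k < m \<longrightarrow> L m < L k)"

lemma ex_first_hit:
  assumes "K \<le> L n"
  shows "\<exists>m. first_hit n m \<and> L m = K"
proof -
  obtain j where j: "j \<in> DS b" "I n + 1 \<le> j" "b j \<le> K" using right_bottleneck_low by blast
  obtain p where p: "I p = j" "L p = b j" "\<And>m. p \<le> m \<longleftrightarrow> j \<le> I m"
    using first_corner[OF j(1)] by blast
  have "n \<le> p" using p(3)[of n] j by simp
  then have "L (n + int (nat (p - n))) \<le> K" using p j by simp
  then have "\<exists>k. L (n + int k) \<le> K" ..
  then obtain k where k: "L (n + int k) \<le> K" and least: "\<And>j. j < k \<Longrightarrow> \<not> L (n + int j) \<le> K"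
    using exists_least_iff[of "\<lambda>k. L (n + int k) \<le> K"] by blast
  have "L (n + int k) = K"
  proof (cases k)
    case 0
    then show ?thesis using k assms by simp
  next
    case (Suc l)
    then have "L (n + int l) > K" using least[of l] by simp
    moreover have "L (n + int k) \<ge> L (n + int l) - 1" using L_step[of "n + int l"] by (simp add: Suc add_ac)
    ultimately show ?thesis using k by simp
  qed
  moreover have "L m > K" if "n \<le> m" "m < n + int k" for m
  proof -
    have "nat (m - n) < k" using that by linarith
    then show ?thesis using least[of "nat (m - n)"] that by simp
  qed
  ultimately show ?thesis unfolding first_hit_def by (intro exI[of _ "n + int k"]) simp
qed

definition s :: "int \<Rightarrow> int" where "s = succ_index b T"

text \<open>\<open>LEAST\<close> over the integers is meaningful only if a minimum exists; the first
  hit of level \<open>L n - 1\<close> supplies it.\<close>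

lemma s_first_hit: "first_hit n (s n)" and L_s: "L (s n) = L n - 1" and less_s: "n < s n"
proof -
  obtain m where m: "first_hit n m" "L m = L n - 1" using ex_first_hit[of "L n - 1" n] by auto
  then have "n \<noteq> m" by auto
  then have "n < m" using m(1) by (simp add: first_hit_def)
  have "s n = m"
    unfolding s_def succ_index_def c_def[symmetric] L_def[symmetric]
  proof (rule Least_equality)
    fix y assume y: "n < y \<and> L y = L n - 1"
    show "m \<le> y"
    proof (rule ccontr)
      assume "\<not> m \<le> y"
      then have "n \<le> y \<and> y < m" using y by simp
      then have "L m < L y" using m(1) unfolding first_hit_def by blast
      then show False using m(2) y by simp
    qed
  qed (use m \<open>n < m\<close> in auto)
  then show "first_hit n (s n)" "L (s n) = L n - 1" "n < s n" using m \<open>n < m\<close> by auto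
qed

lemma L_ge_between: "n \<le> k \<Longrightarrow> k < s n \<Longrightarrow> L n \<le> L k"
  using s_first_hit[of n] L_s[of n] by (force simp: first_hit_def)

lemma edge_iff: "(u, w) \<in> E \<longleftrightarrow> (\<exists>n. u = v n \<and> w = v (s n) \<or> w = v n \<and> u = v (s n))"
  unfolding uihpq_adj_def uihpq_edge_def c_def[symmetric] v_def[symmetric] s_def[symmetric]
  by (auto simp: doubleton_eq_iff)

lemma lab_edge: "(u, w) \<in> E \<Longrightarrow> \<bar>lab u - lab w\<bar> = 1"
  using L_s by (auto simp: edge_iff L_eq[symmetric])

text \<open>A successor step from \<open>n\<close> never passes \<open>m\<close>: all labels before
  \<open>s n\<close> are at least \<open>L n\<close>, which exceeds \<open>L m\<close>.\<close>

lemma path_first_hit: "first_hit n m \<Longrightarrow> (v n, v m) \<in> E ^^ nat (L n - L m)"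
proof (induction "nat (L n - L m)" arbitrary: n)
  case 0
  then have "n = m" by (cases "n = m") (force simp: first_hit_def)+
  then show ?case by simp
next
  case (Suc d)
  have "n < m" using Suc by (cases "n = m") (auto simp: first_hit_def)
  then have "L m < L n" using Suc by (simp add: first_hit_def)
  then have "\<not> m < s n" using L_ge_between[of n m] \<open>n < m\<close> by linarith
  then have "first_hit (s n) m" using Suc less_s[of n] by (simp add: first_hit_def)
  moreover have d: "nat (L (s n) - L m) = d" using Suc(2) L_s[of n] by simp
  ultimately have "(v (s n), v m) \<in> E ^^ d" using Suc(1)[of "s n"] by simp
  moreover have "(v n, v (s n)) \<in> E" by (auto simp: edge_iff)
  ultimately have "(v n, v m) \<in> E ^^ Suc d" by (rule relpow_Suc_I2[rotated])
  then show ?case using Suc(2) by simp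
qed

lemma ex_right_start: "\<exists>a. \<forall>n. a \<le> n \<longleftrightarrow> 0 \<le> I n"
proof -
  obtain j where j: "j \<in> DS b" "0 \<le> j" using right_bottleneck_low by blast
  let ?i = "LEAST k. int k \<in> DS b"
  have "\<exists>k. int k \<in> DS b" using j by (intro exI[of _ "nat j"]) simp
  then have i: "int ?i \<in> DS b" by (rule LeastI_ex)
  have le: "int ?i \<le> i" if "i \<in> DS b" "0 \<le> i" for i
    using Least_le[of "\<lambda>k. int k \<in> DS b" "nat i"] that by simp
  obtain a where "\<And>m. a \<le> m \<longleftrightarrow> int ?i \<le> I m" using first_corner[OF i] by blast
  moreover have "int ?i \<le> I m \<longleftrightarrow> 0 \<le> I m" for m using le[OF I_in_DS] by force
  ultimately show ?thesis by blast
qed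

text \<open>The property determines \<open>a\<close>, the first corner at a non-negative index. The
  origin corner comes at or after it, since corners with other labels may precede it.\<close>

definition a :: int where "a = (SOME a. \<forall>n. a \<le> n \<longleftrightarrow> 0 \<le> I n)"

lemma a_iff: "a \<le> n \<longleftrightarrow> 0 \<le> I n"
  using someI_ex[OF ex_right_start] unfolding a_def by blast

definition hit :: "vertex \<Rightarrow> bool" where
  "hit u \<longleftrightarrow> (\<exists>m. first_hit a m \<and> u = v m)"

section \<open>A fixed geodesic ray\<close>

context
  fixes \<gamma> :: "nat \<Rightarrow> vertex"
  assumes geo: "geodesic_ray V E \<gamma>"
begin

lemma ray_in: "\<gamma> t \<in> V" and ray_edge: "(\<gamma> t, \<gamma> (Suc t)) \<in> E"
  and ray_dist: "graph_dist E (\<gamma> t) (\<gamma> t') = enat (nat \<bar>int t - int t'\<bar>)"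
  using geo by (auto simp: geodesic_ray_def)

lemma ray_path_le:
  assumes "(\<gamma> t, \<gamma> t') \<in> E ^^ n" shows "\<bar>int t - int t'\<bar> \<le> int n"
proof -
  have "graph_dist E (\<gamma> t) (\<gamma> t') \<le> enat n"
    unfolding graph_dist_def using assms by (intro Inf_lower) auto
  then show ?thesis by (simp add: ray_dist)
qed

lemma inj_ray: "inj \<gamma>"
proof (rule injI)
  fix t t' assume "\<gamma> t = \<gamma> t'"
  then have "(\<gamma> t, \<gamma> t') \<in> E ^^ 0" by simp
  from ray_path_le[OF this] show "t = t'" by simp
qed

lemma ray_leaves_finite:
  assumes "finite F" "infinite A" shows "\<exists>t\<in>A. \<gamma> t \<notin> F"
proof (rule ccontr)
  assume "\<not> ?thesis"
  then have "\<gamma> ` A \<subseteq> F" by auto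
  then show False using assms inj_ray by (metis finite_subset finite_imageD inj_on_subset subset_UNIV)
qed

lemma lab_drop: "lab (\<gamma> t) - int d \<le> lab (\<gamma> (t + d))"
proof (induction d)
  case (Suc d)
  then show ?case using lab_edge[OF ray_edge[of "t + d"]] by simp
qed simp

text \<open>Labels change by one per edge, so \<open>t\<close> is at least the label drop from
  \<open>\<gamma> 0\<close> to \<open>\<gamma> t\<close>; the successor path makes it at most this
  drop. Equality forces every step to descend. The condition \<open>low\<close> turns the first hit
  from \<open>a\<close> into a first hit from \<open>n0\<close>, whichever of the two comes
  first.\<close>

lemma proper_until_hit:
  assumes n0: "\<gamma> 0 = v n0" and m: "first_hit a m" "\<gamma> t = v m"
    and low: "\<And>k. min n0 a \<le> k \<Longrightarrow> k \<le> max n0 a \<Longrightarrow> L m < L k" and i: "i < t"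
  shows "lab (\<gamma> (Suc i)) = lab (\<gamma> i) - 1"
proof -
  have "first_hit n0 m"
    unfolding first_hit_def
  proof (intro conjI allI impI)
    show "n0 \<le> m" using low[of m] m(1) by (force simp: first_hit_def)
    show "L m < L k" if "n0 \<le> k \<and> k < m" for k
      using low[of k] m(1) that by (cases "a \<le> k") (auto simp: first_hit_def)
  qed
  then have "(\<gamma> 0, \<gamma> t) \<in> E ^^ nat (L n0 - L m)"
    using path_first_hit n0 m by simp
  moreover have "L n0 \<ge> L m" using low[of n0] by simp
  ultimately have "int t \<le> L n0 - L m" using ray_path_le by fastforce
  then have "int t \<le> lab (\<gamma> 0) - lab (\<gamma> t)" using n0 m by (simp add: L_eq)
  moreover have "lab (\<gamma> 0) - int i \<le> lab (\<gamma> i)" using lab_drop[of 0 i] by simp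
  moreover have "lab (\<gamma> (Suc i)) - int (t - Suc i) \<le> lab (\<gamma> t)" using lab_drop[of "Suc i" "t - Suc i"] i by simp
  ultimately show ?thesis using lab_edge[OF ray_edge[of i]] i by simp
qed

text \<open>There is at most one first hit per label, so only finitely many hits have labels at or
  above \<open>B\<close>. Being injective, the ray therefore meets a hit below \<open>B\<close>
  after any given time.\<close>

lemma proper_if_hits:
  assumes "\<exists>\<^sub>\<infinity>t. hit (\<gamma> t)"
  shows "proper_ray lab \<gamma>"
  unfolding proper_ray_def
proof
  fix i
  obtain n0 where n0: "\<gamma> 0 = v n0" using ex_v[OF ray_in[of 0]] by metis
  define B where "B = Min (L ` {min n0 a..max n0 a})"
  let ?H = "{m. first_hit a m \<and> B \<le> L m}"
  have "inj_on L ?H"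
  proof (rule inj_onI)
    fix m m' assume m: "m \<in> ?H" "m' \<in> ?H" "L m = L m'"
    have "\<not> m < m'" "\<not> m' < m" using m by (auto simp: first_hit_def)
    then show "m = m'" by simp
  qed
  moreover have "L ` ?H \<subseteq> {B..L a}"
  proof
    fix x assume "x \<in> L ` ?H"
    then obtain m where m: "first_hit a m" "B \<le> L m" "x = L m" by auto
    then show "x \<in> {B..L a}" by (cases "m = a") (auto simp: first_hit_def less_imp_le)
  qed
  ultimately have "finite ?H" by (meson finite_imageD finite_subset finite_atLeastAtMost_int)
  then have "finite (v ` ?H)" by simp
  moreover have "infinite {t. i < t \<and> hit (\<gamma> t)}"
  proof -
    have "{t. hit (\<gamma> t)} \<subseteq> {..i} \<union> {t. i < t \<and> hit (\<gamma> t)}" by auto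
    then show ?thesis using assms unfolding INFM_iff_infinite
      by (metis finite_UnI finite_atMost finite_subset)
  qed
  ultimately obtain t where t: "i < t" "hit (\<gamma> t)" "\<gamma> t \<notin> v ` ?H"
    using ray_leaves_finite by blast
  then obtain m where m: "first_hit a m" "\<gamma> t = v m" "L m < B" by (force simp: hit_def)
  have "L m < L k" if "min n0 a \<le> k" "k \<le> max n0 a" for k
  proof -
    have "B \<le> L k" unfolding B_def using that by (intro Min_le) auto
    then show ?thesis using m by simp
  qed
  then show "lab (\<gamma> (Suc i)) = lab (\<gamma> i) - 1"
    using proper_until_hit[OF n0 m(1,2) _ t(1)] by blast
qed

text \<open>The right end of an arc is a first hit from its left end, hence from every corner in
  between, in particular from \<open>a\<close>.\<close>

lemma hit_if_crossing_origin:
  assumes "(0 \<le> fst (\<gamma> t)) \<noteq> (0 \<le> fst (\<gamma> (Suc t)))"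
  shows "hit (\<gamma> t) \<or> hit (\<gamma> (Suc t))"
proof -
  obtain n where n: "\<gamma> t = v n \<and> \<gamma> (Suc t) = v (s n) \<or> \<gamma> (Suc t) = v n \<and> \<gamma> t = v (s n)"
    using ray_edge[of t] by (auto simp: edge_iff)
  then have "(0 \<le> I n) \<noteq> (0 \<le> I (s n))" using assms by (auto simp: fst_v)
  then have "n < a" "a \<le> s n" using a_iff[of n] a_iff[of "s n"] I_mono[of n "s n"] less_s[of n] by auto
  then have "first_hit a (s n)" using s_first_hit[of n] by (simp add: first_hit_def)
  then show ?thesis using n by (auto simp: hit_def)
qed

text \<open>Only finitely many vertices lie between 0 and \<open>j\<close>, so the ray has to get
  across the first corner \<open>p\<close> at \<open>j\<close>. The crossing arc starts above level
  \<open>b j\<close>, so it cannot pass over \<open>p\<close> and must end there.\<close>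

lemma hits_if_eventually_right:
  assumes right_side: "\<And>t. t0 \<le> t \<Longrightarrow> 0 \<le> fst (\<gamma> t)"
  shows "\<exists>\<^sub>\<infinity>t. hit (\<gamma> t)"
  unfolding INFM_nat_le
proof
  fix M
  define t1 where "t1 = max M t0"
  obtain j where j: "j \<in> DS b" "fst (\<gamma> t1) + 1 \<le> j" "0 \<le> j"
      "\<And>i. i \<in> DS b \<Longrightarrow> 0 \<le> i \<Longrightarrow> i < j \<Longrightarrow> labels_in {b j<..} (T i)"
    using right_bottleneck_low by blast
  obtain p where p: "I p = j" "L p = b j" "\<And>m. p \<le> m \<longleftrightarrow> j \<le> I m"
    using first_corner[OF j(1)] by blast
  have "\<exists>t\<in>{t1..}. \<gamma> t \<notin> {u \<in> V. fst u \<in> {0..j}}"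
    by (rule ray_leaves_finite[OF finite_vertices infinite_Ici])
  then obtain t2 where "t1 \<le> t2" "j < fst (\<gamma> t2)"
    using ray_in right_side by (auto simp: t1_def not_le)
  then have "\<exists>d. j \<le> fst (\<gamma> (t1 + d))" by (intro exI[of _ "t2 - t1"]) simp
  then obtain d where d: "j \<le> fst (\<gamma> (t1 + d))" and least: "\<And>d'. d' < d \<Longrightarrow> \<not> j \<le> fst (\<gamma> (t1 + d'))"
    using exists_least_iff[of "\<lambda>d. j \<le> fst (\<gamma> (t1 + d))"] by blast
  have "d \<noteq> 0" using d j(2) by (cases d) auto
  then obtain d' where d': "d = Suc d'" by (cases d) auto
  define t where "t = t1 + d'"
  have t: "fst (\<gamma> t) < j" "j \<le> fst (\<gamma> (Suc t))" "0 \<le> fst (\<gamma> t)"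
    using least[of d'] d d' right_side[of t] by (auto simp: t_def t1_def)
  obtain n where n: "\<gamma> t = v n \<and> \<gamma> (Suc t) = v (s n) \<or> \<gamma> (Suc t) = v n \<and> \<gamma> t = v (s n)"
    using ray_edge[of t] by (auto simp: edge_iff)
  \<comment> \<open>Corners and tree indices are ordered alike, so the arc starts at the vertex to
    the left of \<open>j\<close>.\<close>
  then have n: "\<gamma> t = v n" "\<gamma> (Suc t) = v (s n)"
    using t I_mono[of n "s n"] less_s[of n] by (auto simp: fst_v)
  have "n < p" "p \<le> s n" using p(3)[of n] p(3)[of "s n"] t n by (auto simp: fst_v)
  have low: "L p < L k" if "a \<le> k" "k < p" for k
  proof -
    have "labels_in {b j<..} (T (I k))"
      using j(4)[OF I_in_DS, of k] a_iff[of k] p(3)[of k] that by simp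
    from L_in[OF this] show ?thesis using p(2) by simp
  qed
  have "a \<le> n" using a_iff[of n] t n by (simp add: fst_v)
  then have "L p < L n" using low \<open>n < p\<close> by simp
  then have "\<not> p < s n" using L_ge_between[of n p] \<open>n < p\<close> by linarith
  then have "p = s n" using \<open>p \<le> s n\<close> by simp
  moreover have "first_hit a p"
    using low \<open>a \<le> n\<close> \<open>n < p\<close> by (simp add: first_hit_def)
  ultimately have "hit (\<gamma> (Suc t))" using n by (auto simp: hit_def)
  moreover have "M \<le> Suc t" by (simp add: t_def t1_def)
  ultimately show "\<exists>n\<ge>M. hit (\<gamma> n)" by blast
qed

text \<open>The ray is trapped: to get to or past \<open>j\<close> it would need an arc between a
  corner with label at most \<open>b j\<close> and one to the right of \<open>j\<close> with label
  below \<open>b j\<close>, and before 0 there is none of the latter. Finitely many vertices remain,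
  too few for an injective ray.\<close>

lemma not_eventually_left:
  assumes left_side: "\<And>t. t0 \<le> t \<Longrightarrow> fst (\<gamma> t) < 0"
  shows False
proof -
  obtain j where j: "j \<in> DS b" "j \<le> fst (\<gamma> t0) - 1" "j < 0"
      "\<And>i. i \<in> DS b \<Longrightarrow> j < i \<Longrightarrow> i < 0 \<Longrightarrow> labels_in {b j..} (T i)"
    using left unfolding left_bottlenecks_def by blast
  obtain q where q: "I q = j" "L q = b j" "\<And>m. m \<le> q \<longleftrightarrow> I m \<le> j"
    using last_corner[OF j(1)] by blast
  have stay: "j < fst (\<gamma> (t0 + d))" for d
  proof (induction d)
    case 0
    then show ?case using j by simp
  next
    case (Suc d)
    show ?case
    proof (rule ccontr)
      assume "\<not> j < fst (\<gamma> (t0 + Suc d))"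
      moreover obtain n where "\<gamma> (t0 + d) = v n \<and> \<gamma> (t0 + Suc d) = v (s n) \<or> \<gamma> (t0 + Suc d) = v n \<and> \<gamma> (t0 + d) = v (s n)"
        using ray_edge[of "t0 + d"] by (auto simp: edge_iff)
      ultimately have n: "I n \<le> j" "j < I (s n)" "I (s n) < 0"
        using Suc left_side[of "t0 + d"] I_mono[of n "s n"] less_s[of n] by (auto simp: fst_v)
      then have "n \<le> q" "q < s n" using q(3)[of n] q(3)[of "s n"] by auto
      then have "L n \<le> b j" using L_ge_between[of n q] q(2) by simp
      moreover have "b j \<le> L (s n)"
        using L_in[OF j(4)[OF I_in_DS n(2,3)]] by simp
      ultimately show False using L_s[of n] by simp
    qed
  qed
  have "\<exists>t\<in>{t0..}. \<gamma> t \<notin> {u \<in> V. fst u \<in> {j..0}}"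
    by (rule ray_leaves_finite[OF finite_vertices infinite_Ici])
  then obtain t where "t0 \<le> t" "\<not> (j \<le> fst (\<gamma> t) \<and> fst (\<gamma> t) \<le> 0)" using ray_in by auto
  then show False using stay[of "t - t0"] left_side[of t] by simp
qed

lemma ray_is_proper: "proper_ray lab \<gamma>"
proof -
  define P where "P t \<longleftrightarrow> (0 \<le> fst (\<gamma> t)) \<noteq> (0 \<le> fst (\<gamma> (Suc t)))" for t
  show ?thesis
  proof (cases "\<exists>\<^sub>\<infinity>t. P t")
    case True
    have "\<exists>\<^sub>\<infinity>t. hit (\<gamma> t)"
      unfolding INFM_nat_le
    proof
      fix M
      obtain t where t: "t \<ge> M" "P t"
        using True unfolding INFM_nat_le by blast
      then have "hit (\<gamma> t) \<or> hit (\<gamma> (Suc t))"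
        using hit_if_crossing_origin[of t] by (simp add: P_def)
      then show "\<exists>n\<ge>M. hit (\<gamma> n)"
        using t(1) le_SucI by blast
    qed
    then show ?thesis by (rule proper_if_hits)
  next
    case False
    then obtain t0 where "\<And>t. t0 \<le> t \<Longrightarrow> \<not> P t"
      unfolding INFM_nat_le by blast
    then have t0: "(0 \<le> fst (\<gamma> t)) = (0 \<le> fst (\<gamma> (Suc t)))" if "t0 \<le> t" for t
      using that unfolding P_def by blast
    have side: "(0 \<le> fst (\<gamma> t)) = (0 \<le> fst (\<gamma> t0))" if "t0 \<le> t" for t
      using that
    proof (induction t rule: dec_induct)
      case (step t)
      then show ?case using t0[of t] by blast
    qed simp
    show ?thesis
    proof (cases "0 \<le> fst (\<gamma> t0)")
      case True
      have "0 \<le> fst (\<gamma> t)" if "t0 \<le> t" for t using True side[OF that] by blast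
      then have "\<exists>\<^sub>\<infinity>t. hit (\<gamma> t)" by (rule hits_if_eventually_right)
      then show ?thesis by (rule proper_if_hits)
    next
      case False
      have "fst (\<gamma> t) < 0" if "t0 \<le> t" for t using False side[OF that] by linarith
      then have False by (rule not_eventually_left)
      then show ?thesis ..
    qed
  qed
qed

end

end

theorem corollary1:
  fixes M :: "'w measure" and b :: "'w \<Rightarrow> int \<Rightarrow> int" and T :: "'w \<Rightarrow> int \<Rightarrow> ltree"
  assumes "uniform_infinite_treed_bridge M b T"
  shows "AE \<omega> in M. \<forall>\<gamma>.
           geodesic_ray (real_vertices (b \<omega>) (T \<omega>)) (uihpq_adj (b \<omega>) (T \<omega>)) \<gamma> \<longrightarrow>
           proper_ray (vertex_label (T \<omega>)) \<gamma>"
proof -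
  interpret uniform_infinite_treed_bridge M b T by (rule assms)
  show ?thesis
    using AE_pm_steps AE_good_trees AE_right_bottlenecks AE_left_bottlenecks
    by eventually_elim
       (intro allI impI bottlenecked_bridge.ray_is_proper bottlenecked_bridge.intro)
qed

end
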